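(* Let $p$ be an odd prime, let $D>1$ be any integer coprime to $p$, and let $\eta$ be a primitive Dirichlet character of conductor $D$. There exists a unique measure $\zeta_\eta\in\Lambda(\mathbf{Z}_p^\times)$ such that, for all primitive Dirichlet characters $\chi$ with conductor $p^n$, $n\ge0$, and for all integers $k>0$, $$\int_{\mathbf{Z}_p^\times}\chi(x)x^k\cdot\zeta_\eta=\bigl(1-\chi\eta(p)p^{k-1}\bigr)L(\chi\eta,1-k).$$
   Context: Fix embeddings of $\overline{\mathbf{Q}}$ into $\mathbf{C}$ and $\mathbf{C}_p$. The coefficient field is a sufficiently large fixed finite extension $L/\mathbf{Q}_p$ containing the values of $\eta$, with ring of integers $\mathcal{O}_L$. $\Lambda(\mathbf{Z}_p^\times)=\varprojlim_n\mathcal{O}_L[(\mathbf{Z}/p^n\mathbf{Z})^\times]$ is identified with the space of $\mathcal{O}_L$-valued measures on $\mathbf{Z}_p^\times$, i.e. continuous $\mathcal{O}_L$-linear functionals $\phi\mapsto\int_{\mathbf{Z}_p^\times}\phi\cdot\mu$ on continuous functions $\mathbf{Z}_p^\times\to\mathcal{O}_L$ (extended to continuous $\mathbf{C}_p$-valued functions). A Dirichlet character $\chi$ of conductor $p^n$ is viewed as a character of $\mathbf{Z}_p^\times$ via $\mathbf{Z}_p^\times\to(\mathbf{Z}/p^n\mathbf{Z})^\times$. $\chi\eta$ is the product character, of conductor $Dp^n$ (extended by $0$ to integers not coprime to its conductor), and $L(\chi\eta,s)$ is its analytically continued Dirichlet $L$-function. *)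

theory Defs
  imports
    "HOL-Algebra.Algebraic_Closure_Type"
    "HOL-Number_Theory.Number_Theory"
    "HOL-Complex_Analysis.Complex_Analysis"
begin

section \<open>The field of p-adic complex numbers\<close>

text \<open>
  Since a type cannot depend on \<open>p\<close>, the field of \<open>p\<close>-adic complex numbers is a type \<open>'c\<close>
  whose metric is the one of the \<open>p\<close>-adic absolute value \<open>pabs\<close>. The sets \<open>Qp\<close> and \<open>Zp\<close>
  are the completions of the rationals and of the integers inside the complete space \<open>'c\<close>, and
  \<open>Qp_bar\<close> consists of the elements algebraic over \<open>Qp\<close>.
\<close>

definition pabs :: "'c::{field_char_0, complete_space} \<Rightarrow> real" where
  "pabs x = dist x 0"

definition Qp :: "'c::{field_char_0, complete_space} set" where
  "Qp = closure \<rat>"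

definition Zp :: "'c::{field_char_0, complete_space} set" where
  "Zp = closure \<int>"

definition Zp_units :: "'c::{field_char_0, complete_space} set" where
  "Zp_units = {x \<in> Zp. \<exists>y\<in>Zp. x * y = 1}"

definition Qp_bar :: "'c::{field_char_0, complete_space} set" where
  "Qp_bar = {x. \<exists>f. f \<noteq> 0 \<and> (\<forall>i. Polynomial.coeff f i \<in> Qp) \<and> poly f x = 0}"

text \<open>
  The locale says that \<open>'c\<close> is the completion of an algebraic closure of the completion of the
  rationals at \<open>p\<close>; this determines \<open>'c\<close> up to isometric isomorphism.
\<close>

locale padic_complex_field =
  fixes ty :: "'c::{field_char_0, complete_space} itself" and p :: nat
  assumes prime_p: "Factorial_Ring.prime p"
    and dist_pabs: "dist x y = pabs (x - y :: 'c)"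
    and pabs_mult: "pabs (x * y :: 'c) = pabs x * pabs y"
    and pabs_add: "pabs (x + y :: 'c) \<le> max (pabs x) (pabs y)"
    and pabs_p: "pabs (of_nat p :: 'c) = 1 / real p"
    and Qp_bar_closed: "(\<forall>i. Polynomial.coeff f i \<in> (Qp_bar :: 'c set)) \<Longrightarrow> Polynomial.degree f > 0 \<Longrightarrow>
          \<exists>x\<in>Qp_bar. poly f x = 0"
    and Qp_bar_dense: "closure Qp_bar = (UNIV :: 'c set)"

definition field_embedding :: "('a::field \<Rightarrow> 'b::field) \<Rightarrow> bool" where
  "field_embedding f \<longleftrightarrow>
     f 1 = 1 \<and> (\<forall>x y. f (x + y) = f x + f y) \<and> (\<forall>x y. f (x * y) = f x * f y)"

definition finite_extension_Qp :: "'c::{field_char_0, complete_space} set \<Rightarrow> bool" where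
  "finite_extension_Qp L \<longleftrightarrow>
     Qp \<subseteq> L \<and>
     (\<forall>x\<in>L. \<forall>y\<in>L. x - y \<in> L \<and> x * y \<in> L \<and> inverse x \<in> L) \<and>
     (\<exists>B. finite B \<and> L = {\<Sum>b\<in>B. c b * b | c. c ` B \<subseteq> Qp})"

definition ring_of_integers :: "'c::{field_char_0, complete_space} set \<Rightarrow> 'c set" where
  "ring_of_integers L = {x \<in> L. pabs x \<le> 1}"


section \<open>Dirichlet characters and their L-functions\<close>

definition dirichlet_character :: "nat \<Rightarrow> (int \<Rightarrow> 'a::field) \<Rightarrow> bool" where
  "dirichlet_character N \<psi> \<longleftrightarrow>
     N > 0 \<and> \<psi> 1 = 1 \<and>
     (\<forall>a b. \<psi> (a * b) = \<psi> a * \<psi> b) \<and>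
     (\<forall>a. \<psi> (a + int N) = \<psi> a) \<and>
     (\<forall>a. \<psi> a = 0 \<longleftrightarrow> \<not> coprime a (int N))"

text \<open>
  Primitive of conductor \<open>N\<close>: the character of the units modulo \<open>N\<close> does not factor through the
  units modulo any proper divisor of \<open>N\<close>. For \<open>N = 1\<close> this is the constant function 1.
\<close>

definition primitive_dirichlet_character :: "nat \<Rightarrow> (int \<Rightarrow> 'a::field) \<Rightarrow> bool" where
  "primitive_dirichlet_character N \<psi> \<longleftrightarrow>
     dirichlet_character N \<psi> \<and>
     (\<forall>d. d dvd N \<and> d < N \<longrightarrow>
        (\<exists>a. coprime a (int N) \<and> [a = 1] (mod int d) \<and> \<psi> a \<noteq> 1))"

text \<open>
  The analytic continuation is unique away from the possible pole at \<open>s = 1\<close>, so the value is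
  meaningful for \<open>s \<noteq> 1\<close>.
\<close>

definition dirichlet_L :: "(int \<Rightarrow> complex) \<Rightarrow> complex \<Rightarrow> complex" where
  "dirichlet_L \<psi> = (SOME f. f holomorphic_on - {1} \<and>
     (\<forall>s. Re s > 1 \<longrightarrow> (\<lambda>n. \<psi> (int (Suc n)) / of_nat (Suc n) powr s) sums f s))"


section \<open>Measures on the p-adic units\<close>

text \<open>
  \<open>totatives (p ^ n)\<close> is a set of representatives of the units modulo \<open>p ^ n\<close> (it is \<open>{1}\<close> for
  \<open>n = 0\<close>). An element of the inverse limit of the group rings over these unit groups is a family
  \<open>\<mu>\<close>, where \<open>\<mu> n a\<close> is the coefficient of the class of \<open>a\<close> modulo \<open>p ^ n\<close>, that is, the measure
  of the coset \<open>a + p ^ n Zp\<close>. Setting \<open>\<mu> n a = 0\<close> off the representatives makes the family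
  unique.
\<close>

definition iwasawa_algebra ::
    "nat \<Rightarrow> 'c::{field_char_0, complete_space} set \<Rightarrow> (nat \<Rightarrow> nat \<Rightarrow> 'c) set" where
  "iwasawa_algebra p L = {\<mu>.
     (\<forall>n. \<forall>a\<in>totatives (p ^ n). \<mu> n a \<in> ring_of_integers L) \<and>
     (\<forall>n a. a \<notin> totatives (p ^ n) \<longrightarrow> \<mu> n a = 0) \<and>
     (\<forall>n. \<forall>b\<in>totatives (p ^ n).
        (\<Sum>a | a \<in> totatives (p ^ Suc n) \<and> [a = b] (mod p ^ n). \<mu> (Suc n) a) = \<mu> n b)}"

definition riemann_sum ::
    "nat \<Rightarrow> (nat \<Rightarrow> nat \<Rightarrow> 'c::{field_char_0, complete_space}) \<Rightarrow> ('c \<Rightarrow> 'c) \<Rightarrow> nat \<Rightarrow> 'c" where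
  "riemann_sum p \<mu> \<phi> n = (\<Sum>a\<in>totatives (p ^ n). \<phi> (of_nat a) * \<mu> n a)"

definition measure_integral ::
    "nat \<Rightarrow> (nat \<Rightarrow> nat \<Rightarrow> 'c::{field_char_0, complete_space}) \<Rightarrow> ('c \<Rightarrow> 'c) \<Rightarrow> 'c" where
  "measure_integral p \<mu> \<phi> = lim (riemann_sum p \<mu> \<phi>)"

definition unit_residue :: "nat \<Rightarrow> nat \<Rightarrow> 'c::{field_char_0, complete_space} \<Rightarrow> nat" where
  "unit_residue p n x = (THE a. a \<in> totatives (p ^ n) \<and> (\<exists>y\<in>Zp. x - of_nat a = of_nat p ^ n * y))"

text \<open>A Dirichlet character modulo \<open>p ^ n\<close>, viewed as a function on \<open>Zp_units\<close>.\<close>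

definition char_on_units ::
    "nat \<Rightarrow> nat \<Rightarrow> (int \<Rightarrow> 'a) \<Rightarrow> 'c::{field_char_0, complete_space} \<Rightarrow> 'a" where
  "char_on_units p n \<psi> x = \<psi> (int (unit_residue p n x))"


section \<open>The integral as a continuous linear functional\<close>

text \<open>
  For \<open>\<mu>\<close> in the Iwasawa algebra the Riemann sums of every continuous function converge, and the
  integral is the linear functional of norm at most 1 on the continuous functions whose value on the
  indicator function of \<open>b + p ^ n Zp\<close> is \<open>\<mu> n b\<close>.
\<close>

context padic_complex_field
begin

lemma p_gt_1: "p > 1"
  using prime_p by (rule prime_gt_1_nat)

lemma pabs_nonneg: "pabs (x :: 'c) \<ge> 0"
  by (simp add: pabs_def)

lemma pabs_eq_0_iff: "pabs (x :: 'c) = 0 \<longleftrightarrow> x = 0"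
  by (simp add: pabs_def)

lemma pabs_1: "pabs (1 :: 'c) = 1"
  using pabs_mult[of 1 1] pabs_eq_0_iff[of 1] by auto

lemma pabs_minus: "pabs (- x :: 'c) = pabs x"
  using dist_pabs[of 0 x] by (simp add: pabs_def dist_commute)

lemma pabs_diff: "pabs (x - y :: 'c) \<le> max (pabs x) (pabs y)"
  using pabs_add[of x "- y"] by (simp add: pabs_minus)

lemma pabs_power: "pabs (x ^ n :: 'c) = pabs x ^ n"
  by (induction n) (auto simp: pabs_1 pabs_mult)

lemma pabs_of_nat: "pabs (of_nat n :: 'c) \<le> 1"
proof (induction n)
  case 0
  then show ?case by (simp add: pabs_def)
next
  case (Suc n)
  then show ?case using pabs_add[of 1 "of_nat n"] by (simp add: pabs_1)
qed

lemma pabs_of_int: "pabs (of_int n :: 'c) \<le> 1"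
  by (cases n) (use pabs_of_nat[of "Suc _"] pabs_of_nat in \<open>simp_all add: pabs_minus del: of_nat_Suc\<close>)

lemma pabs_sum_le:
  assumes "C \<ge> 0" and "\<And>i. i \<in> A \<Longrightarrow> pabs (f i :: 'c) \<le> C"
  shows "pabs (sum f A) \<le> C"
  using assms(2)
proof (induction A rule: infinite_finite_induct)
  case (insert x F)
  then have "pabs (f x) \<le> C" "pabs (sum f F) \<le> C"
    by auto
  then show ?case
    using insert.hyps pabs_add[of "f x" "sum f F"] by (simp add: max_def split: if_splits)
qed (use assms(1) in \<open>auto simp: pabs_def\<close>)

lemma pabs_p_power: "pabs (of_nat (p ^ n) :: 'c) = 1 / real p ^ n"
  by (simp add: pabs_power pabs_p power_one_over)

lemma pabs_of_int_coprime:
  assumes "coprime a (int p)"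
  shows "pabs (of_int a :: 'c) = 1"
proof -
  obtain u v where "a * u + int p * v = 1"
    using bezout_int[of a "int p"] assms by (auto simp: coprime_iff_gcd_eq_1 mult.commute)
  then have "(1 :: 'c) = of_int (a * u + int p * v)"
    by simp
  then have "pabs (1 :: 'c) \<le> max (pabs (of_int (a * u) :: 'c)) (pabs (of_int (int p * v) :: 'c))"
    using pabs_add[of "of_int (a * u)" "of_int (int p * v)"] by simp
  moreover have "pabs (of_int (int p * v) :: 'c) < 1"
  proof -
    have "pabs (of_int (int p * v) :: 'c) = (1 / real p) * pabs (of_int v :: 'c)"
      by (simp add: pabs_mult pabs_p)
    also have "\<dots> \<le> (1 / real p) * 1"
      by (intro mult_left_mono pabs_of_int) auto
    also have "\<dots> < 1"
      using p_gt_1 by simp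
    finally show ?thesis .
  qed
  ultimately have "1 \<le> pabs (of_int (a * u) :: 'c)"
    by (simp add: pabs_1)
  also have "\<dots> = pabs (of_int a :: 'c) * pabs (of_int u :: 'c)"
    by (simp add: pabs_mult)
  also have "\<dots> \<le> pabs (of_int a :: 'c) * 1"
    by (intro mult_left_mono pabs_of_int pabs_nonneg)
  finally show ?thesis
    using pabs_of_int[of a] by simp
qed

lemma pabs_of_int_le_iff: "pabs (of_int a :: 'c) \<le> 1 / real p ^ n \<longleftrightarrow> int p ^ n dvd a"
proof
  assume "int p ^ n dvd a"
  then obtain b where "a = int p ^ n * b" ..
  then have "pabs (of_int a :: 'c) = (1 / real p ^ n) * pabs (of_int b :: 'c)"
    using pabs_p_power[of n] by (simp add: pabs_mult)
  also have "\<dots> \<le> (1 / real p ^ n) * 1"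
    by (intro mult_left_mono pabs_of_int) auto
  finally show "pabs (of_int a :: 'c) \<le> 1 / real p ^ n"
    by simp
next
  assume *: "pabs (of_int a :: 'c) \<le> 1 / real p ^ n"
  show "int p ^ n dvd a"
  proof (cases "a = 0")
    case False
    have "\<not> is_unit (int p)"
      using p_gt_1 by auto
    then obtain b where b: "a = int p ^ multiplicity (int p) a * b" "\<not> int p dvd b"
      using multiplicity_decompose'[OF False, of "int p"] by metis
    let ?m = "multiplicity (int p) a"
    have "Factorial_Ring.prime (int p)"
      using prime_p by simp
    then have "coprime b (int p)"
      using b(2) prime_imp_coprime[of "int p" b] by (simp add: coprime_commute)
    then have "pabs (of_int a :: 'c) = 1 / real p ^ ?m"
      using pabs_p_power[of ?m] pabs_of_int_coprime[of b] by (subst b(1)) (simp add: pabs_mult)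
    with * have "real p ^ n \<le> real p ^ ?m"
      using p_gt_1 by (simp add: field_simps)
    then have "n \<le> ?m"
      using p_gt_1 by simp
    then show ?thesis
      by (metis b(1) dvd_mult2 le_imp_power_dvd)
  qed auto
qed

lemma inv_p_power_tendsto_0: "(\<lambda>n. 1 / real p ^ n) \<longlonglongrightarrow> 0"
  using LIMSEQ_inverse_realpow_zero[of "real p"] p_gt_1 by (simp add: divide_inverse)

lemma ex_inv_p_power_less:
  assumes "e > 0"
  shows "\<exists>n. 1 / real p ^ n < e"
  using order_tendstoD(2)[OF inv_p_power_tendsto_0 assms] by (auto dest: eventually_happens)

lemma pabs_Zp_le_1:
  assumes "x \<in> (Zp :: 'c set)"
  shows "pabs x \<le> 1"
proof -
  from assms obtain y where "y \<in> \<int>" "dist y x < 1"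
    unfolding Zp_def by (meson closure_approachable zero_less_one)
  then have "pabs y \<le> 1" "pabs (y - x) \<le> 1"
    by (auto elim!: Ints_cases simp: pabs_of_int dist_pabs)
  then show ?thesis
    using pabs_diff[of y "y - x"] by simp
qed

lemma compact_Zp: "compact (Zp :: 'c set)"
  unfolding compact_eq_totally_bounded
proof (intro conjI allI impI)
  show "complete (Zp :: 'c set)"
    by (simp add: Zp_def complete_eq_closed)
  fix e :: real assume "e > 0"
  then obtain n where n: "1 / real p ^ n < e / 2"
    using ex_inv_p_power_less[of "e / 2"] by auto
  define K where "K = (of_int :: int \<Rightarrow> 'c) ` {0..<int p ^ n}"
  have "Zp \<subseteq> (\<Union>x\<in>K. ball x e)"
  proof
    fix x :: 'c assume "x \<in> Zp"
    then obtain y where "y \<in> \<int>" "dist y x < e / 2"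
      unfolding Zp_def using \<open>e > 0\<close> by (metis closure_approachable half_gt_zero)
    then obtain a where a: "dist (of_int a) x < e / 2"
      by (auto elim!: Ints_cases)
    have "dist (of_int a) (of_int (a mod int p ^ n) :: 'c) \<le> 1 / real p ^ n"
      using pabs_of_int_le_iff[of "a - a mod int p ^ n" n] by (simp add: dist_pabs)
    with a n have "dist (of_int (a mod int p ^ n)) x < e"
      using dist_triangle[of "of_int (a mod int p ^ n)" x "of_int a"] by (simp add: dist_commute)
    moreover have "a mod int p ^ n \<in> {0..<int p ^ n}"
      using p_gt_1 by simp
    ultimately show "x \<in> (\<Union>x\<in>K. ball x e)"
      unfolding K_def by auto
  qed
  then show "\<exists>K. finite K \<and> Zp \<subseteq> (\<Union>x\<in>K. ball (x :: 'c) e)"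
    by (intro exI[of _ K]) (auto simp: K_def)
qed

lemma Zp_inverse:
  assumes "x \<in> Zp" "pabs x = 1"
  shows "inverse (x :: 'c) \<in> Zp"
  unfolding Zp_def closure_approachable
proof (intro allI impI)
  fix e :: real assume "e > 0"
  then have "min e 1 > 0" by simp
  then obtain y where y: "y \<in> \<int>" "dist y x < min e 1"
    using assms(1) unfolding Zp_def by (meson closure_approachable)
  then obtain a where a: "dist (of_int a) x < min e 1"
    by (auto elim!: Ints_cases)
  obtain n where n: "1 / real p ^ n < e"
    using ex_inv_p_power_less[OF \<open>e > 0\<close>] by auto
  have "pabs (of_int a :: 'c) = 1"
  proof -
    have "1 \<le> max (pabs (of_int a :: 'c)) (pabs (of_int a - x))"
      using pabs_diff[of "of_int a" "of_int a - x"] assms(2) by simp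
    then show ?thesis
      using a pabs_of_int[of a] by (auto simp: dist_pabs max_def split: if_splits)
  qed
  then have "\<not> int p dvd a"
    using pabs_of_int_le_iff[of a 1] p_gt_1 by simp
  then have "coprime a (int p ^ n)"
    using prime_p prime_imp_coprime[of "int p" a] by (simp add: coprime_commute)
  then obtain u v where uv: "a * u + int p ^ n * v = 1"
    using bezout_int[of a "int p ^ n"] by (auto simp: coprime_iff_gcd_eq_1 mult.commute)
  have "x \<noteq> 0"
    using assms(2) pabs_eq_0_iff[of x] by auto
  have "of_int u - inverse x = inverse x * ((x - of_int a) * of_int u - of_int (1 - a * u))"
    using \<open>x \<noteq> 0\<close> by (simp add: field_simps)
  moreover have "pabs (inverse x) = 1"
    using pabs_mult[of x "inverse x"] \<open>x \<noteq> 0\<close> assms(2) by (simp add: pabs_1)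
  ultimately have "pabs (of_int u - inverse x) =
      pabs ((x - of_int a) * of_int u - of_int (1 - a * u))"
    by (simp add: pabs_mult)
  also have "\<dots> \<le> max (pabs ((x - of_int a) * of_int u)) (pabs (of_int (1 - a * u) :: 'c))"
    by (rule pabs_diff)
  also have "\<dots> < e"
  proof -
    have "int p ^ n dvd 1 - a * u"
      using uv by (metis add_diff_cancel_left' dvd_triv_left)
    then have "pabs (of_int (1 - a * u) :: 'c) < e"
      using pabs_of_int_le_iff[of "1 - a * u" n] n by linarith
    moreover have "pabs (x - of_int a) * pabs (of_int u :: 'c) \<le> pabs (x - of_int a) * 1"
      by (intro mult_left_mono pabs_of_int pabs_nonneg)
    then have "pabs ((x - of_int a) * of_int u) < e"
      using a by (simp add: pabs_mult dist_pabs[symmetric] dist_commute)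
    ultimately show ?thesis by simp
  qed
  finally show "\<exists>y\<in>\<int>. dist y (inverse x) < e"
    by (intro bexI[of _ "of_int u"]) (auto simp: dist_pabs)
qed

lemma Zp_units_eq: "(Zp_units :: 'c set) = Zp \<inter> {x. pabs x = 1}"
proof (intro equalityI subsetI)
  fix x :: 'c assume "x \<in> Zp_units"
  then obtain y where xy: "x \<in> Zp" "y \<in> Zp" "x * y = 1"
    by (auto simp: Zp_units_def)
  then have "pabs x * pabs y = 1"
    by (metis pabs_mult pabs_1)
  moreover have "pabs x * pabs y \<le> pabs x * 1"
    using xy by (intro mult_left_mono pabs_Zp_le_1 pabs_nonneg)
  ultimately show "x \<in> Zp \<inter> {x. pabs x = 1}"
    using pabs_Zp_le_1[OF xy(1)] xy(1) by simp
next
  fix x :: 'c assume x: "x \<in> Zp \<inter> {x. pabs x = 1}"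
  then have "x \<noteq> 0"
    using pabs_eq_0_iff[of x] by auto
  then show "x \<in> Zp_units"
    using x Zp_inverse[of x] by (auto simp: Zp_units_def intro!: bexI[of _ "inverse x"])
qed

lemma compact_Zp_units: "compact (Zp_units :: 'c set)"
proof -
  have "closed {x :: 'c. pabs x = 1}"
    unfolding pabs_def by (intro closed_Collect_eq continuous_intros)
  then show ?thesis
    unfolding Zp_units_eq by (intro compact_Int_closed compact_Zp)
qed

lemma of_nat_in_Zp_units:
  assumes "a \<in> totatives (p ^ n)" "n > 0"
  shows "(of_nat a :: 'c) \<in> Zp_units"
proof -
  have "coprime (int a) (int p)"
    using assms by (auto simp: in_totatives_iff)
  then have "pabs (of_nat a :: 'c) = 1"
    using pabs_of_int_coprime[of "int a"] by simp
  moreover have "(of_nat a :: 'c) \<in> Zp"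
    unfolding Zp_def by (meson Ints_of_nat closure_subset subsetD)
  ultimately show ?thesis
    by (simp add: Zp_units_eq)
qed

definition totative_mod :: "nat \<Rightarrow> nat \<Rightarrow> nat" where
  "totative_mod n a = (if n = 0 then 1 else a mod p ^ n)"

lemma totative_mod_in:
  assumes "a \<in> totatives (p ^ m)" "n \<le> m"
  shows "totative_mod n a \<in> totatives (p ^ n)"
proof (cases "n = 0")
  case False
  have "coprime a p"
    using assms False by (auto simp: in_totatives_iff)
  then have "coprime (a mod p ^ n) (p ^ n)"
    using p_gt_1 coprime_mod_left_iff[of "p ^ n" a] coprime_power_right_iff[of a p n] by simp
  moreover from this have "a mod p ^ n > 0"
    using p_gt_1 False by (intro Nat.gr0I) auto
  ultimately show ?thesis
    using p_gt_1 False by (auto simp: totative_mod_def in_totatives_iff less_imp_le)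
qed (auto simp: totative_mod_def in_totatives_iff)

lemma totative_mod_eq_iff:
  assumes "b \<in> totatives (p ^ n)"
  shows "totative_mod n a = b \<longleftrightarrow> [a = b] (mod p ^ n)"
proof (cases "n = 0")
  case False
  have "b < p ^ n"
    using assms False p_gt_1 totatives_less[of b "p ^ n"] one_less_power[of p n] by simp
  then show ?thesis
    using False by (simp add: totative_mod_def Cong.cong_def)
qed (use assms in \<open>auto simp: totative_mod_def in_totatives_iff Cong.cong_def\<close>)

lemma sum_totatives_regroup:
  "(\<Sum>b\<in>totatives (p ^ n). \<Sum>a | a \<in> totatives (p ^ Suc n) \<and> [a = b] (mod p ^ n). f a)
    = (\<Sum>a\<in>totatives (p ^ Suc n). f a :: 'c)"
proof -
  have "(\<Sum>b\<in>totatives (p ^ n). \<Sum>a | a \<in> totatives (p ^ Suc n) \<and> [a = b] (mod p ^ n). f a) =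
      (\<Sum>b\<in>totatives (p ^ n). \<Sum>a | a \<in> totatives (p ^ Suc n) \<and> totative_mod n a = b. f a)"
    by (intro sum.cong refl) (auto simp: totative_mod_eq_iff)
  also have "\<dots> = sum f (totatives (p ^ Suc n))"
    by (intro sum.group) (auto intro: totative_mod_in[of _ "Suc n"] simp del: power_Suc)
  finally show ?thesis .
qed

lemma riemann_sum_diff_le:
  assumes \<mu>: "\<mu> \<in> iwasawa_algebra p (L :: 'c set)" and "n > 0" "e \<ge> 0"
    and \<phi>: "\<And>x y. x \<in> Zp_units \<Longrightarrow> y \<in> Zp_units \<Longrightarrow> dist x y \<le> 1 / real p ^ n \<Longrightarrow>
          dist (\<phi> x) (\<phi> y) \<le> e"
  shows "dist (riemann_sum p \<mu> \<phi> (Suc n)) (riemann_sum p \<mu> \<phi> n) \<le> e"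
proof -
  let ?T = "\<lambda>n. totatives (p ^ n)" and ?A = "\<lambda>b. {a \<in> totatives (p ^ Suc n). [a = b] (mod p ^ n)}"
  have "riemann_sum p \<mu> \<phi> n = (\<Sum>b\<in>?T n. \<Sum>a\<in>?A b. \<phi> (of_nat b) * \<mu> (Suc n) a)"
    using \<mu> by (auto simp: riemann_sum_def iwasawa_algebra_def sum_distrib_left[symmetric]
        simp del: power_Suc intro!: sum.cong)
  then have eq: "riemann_sum p \<mu> \<phi> (Suc n) - riemann_sum p \<mu> \<phi> n =
      (\<Sum>b\<in>?T n. \<Sum>a\<in>?A b. (\<phi> (of_nat a) - \<phi> (of_nat b)) * \<mu> (Suc n) a)"
    by (simp add: riemann_sum_def sum_totatives_regroup[symmetric] sum_subtractf left_diff_distrib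
        del: power_Suc)
  show ?thesis
    unfolding dist_pabs eq
  proof (intro pabs_sum_le \<open>e \<ge> 0\<close>)
    fix b a assume b: "b \<in> ?T n" and a: "a \<in> ?A b"
    have "int p ^ n dvd int a - int b"
      using a by (auto simp: cong_int_iff[symmetric] cong_iff_dvd_diff)
    then have "dist (of_nat a) (of_nat b :: 'c) \<le> 1 / real p ^ n"
      using pabs_of_int_le_iff[of "int a - int b" n] by (simp add: dist_pabs)
    then have "pabs (\<phi> (of_nat a) - \<phi> (of_nat b)) \<le> e"
      using \<phi> of_nat_in_Zp_units[of a "Suc n"] of_nat_in_Zp_units[of b n] a b \<open>n > 0\<close>
      by (auto simp: dist_pabs)
    moreover have "pabs (\<mu> (Suc n) a) \<le> 1"
      using \<mu> a unfolding iwasawa_algebra_def ring_of_integers_def by blast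
    ultimately show "pabs ((\<phi> (of_nat a) - \<phi> (of_nat b)) * \<mu> (Suc n) a) \<le> e"
      using mult_mono[of "pabs (\<phi> (of_nat a) - \<phi> (of_nat b))" e "pabs (\<mu> (Suc n) a)" 1]
        \<open>e \<ge> 0\<close> by (simp add: pabs_mult pabs_nonneg)
  qed
qed

theorem riemann_sum_convergent:
  assumes \<mu>: "\<mu> \<in> iwasawa_algebra p (L :: 'c set)" and \<phi>: "continuous_on Zp_units \<phi>"
  shows "convergent (riemann_sum p \<mu> \<phi>)"
proof -
  have "Cauchy (riemann_sum p \<mu> \<phi>)"
    unfolding metric_Cauchy_iff2
  proof
    fix j
    define e :: real where "e = inverse (real (Suc j)) / 2"
    have e: "0 < e" "e < inverse (real (Suc j))"
      by (auto simp: e_def)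
    have "uniformly_continuous_on Zp_units \<phi>"
      by (intro compact_uniformly_continuous \<phi> compact_Zp_units)
    then obtain d where d: "d > 0"
      "\<And>x y. x \<in> Zp_units \<Longrightarrow> y \<in> Zp_units \<Longrightarrow> dist x y < d \<Longrightarrow> dist (\<phi> x) (\<phi> y) < e"
      using e(1) unfolding uniformly_continuous_on_def by metis
    have "eventually (\<lambda>n. 1 / real p ^ n < d \<and> n > 0) sequentially"
      using order_tendstoD(2)[OF inv_p_power_tendsto_0 d(1)] eventually_gt_at_top[of 0]
      by eventually_elim auto
    then obtain N where N: "\<And>n. n \<ge> N \<Longrightarrow> 1 / real p ^ n < d" "\<And>n. n \<ge> N \<Longrightarrow> n > 0"
      unfolding eventually_sequentially by blast
    have step: "dist (riemann_sum p \<mu> \<phi> (Suc n)) (riemann_sum p \<mu> \<phi> n) \<le> e" if "n \<ge> N" for n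
      using N[OF that] d(2) e(1) by (intro riemann_sum_diff_le[OF \<mu>]) (auto intro: less_imp_le)
    have ultra: "dist x z \<le> max (dist x y) (dist y z)" for x y z :: 'c
      using pabs_add[of "x - y" "y - z"] by (simp add: dist_pabs)
    have base: "dist (riemann_sum p \<mu> \<phi> n) (riemann_sum p \<mu> \<phi> N) \<le> e" if "n \<ge> N" for n
      using that
    proof (induction n rule: dec_induct)
      case (step n)
      then show ?case
        using ultra[of "riemann_sum p \<mu> \<phi> (Suc n)" "riemann_sum p \<mu> \<phi> N" "riemann_sum p \<mu> \<phi> n"]
          \<open>\<And>n. n \<ge> N \<Longrightarrow> dist (riemann_sum p \<mu> \<phi> (Suc n)) (riemann_sum p \<mu> \<phi> n) \<le> e\<close>[of n]
        by simp
    qed (use e in auto)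
    show "\<exists>M. \<forall>m\<ge>M. \<forall>n\<ge>M.
        dist (riemann_sum p \<mu> \<phi> m) (riemann_sum p \<mu> \<phi> n) < inverse (real (Suc j))"
    proof (intro exI[of _ N] allI impI)
      fix m n assume "m \<ge> N" "n \<ge> N"
      then show "dist (riemann_sum p \<mu> \<phi> m) (riemann_sum p \<mu> \<phi> n) < inverse (real (Suc j))"
        using base[of m] base[of n] e(2)
          ultra[of "riemann_sum p \<mu> \<phi> m" "riemann_sum p \<mu> \<phi> n" "riemann_sum p \<mu> \<phi> N"]
        by (simp add: dist_commute)
    qed
  qed
  then show ?thesis
    by (rule Cauchy_convergent)
qed

lemma riemann_sum_tendsto:
  assumes "\<mu> \<in> iwasawa_algebra p (L :: 'c set)" "continuous_on Zp_units \<phi>"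
  shows "riemann_sum p \<mu> \<phi> \<longlonglongrightarrow> measure_integral p \<mu> \<phi>"
  using riemann_sum_convergent[OF assms] by (simp add: measure_integral_def convergent_LIMSEQ_iff)

lemma tendsto_iff_pabs: "(f \<longlongrightarrow> l) F \<longleftrightarrow> ((\<lambda>x. pabs (f x - l :: 'c)) \<longlongrightarrow> 0) F"
  by (subst tendsto_dist_iff) (simp add: dist_pabs)

theorem measure_integral_add:
  assumes \<mu>: "\<mu> \<in> iwasawa_algebra p (L :: 'c set)"
    and "continuous_on Zp_units \<phi>" "continuous_on Zp_units \<phi>'"
  shows "measure_integral p \<mu> (\<lambda>x. \<phi> x + \<phi>' x) = measure_integral p \<mu> \<phi> + measure_integral p \<mu> \<phi>'"
proof -
  let ?I = "measure_integral p \<mu> \<phi>" and ?I' = "measure_integral p \<mu> \<phi>'"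
  have "(\<lambda>n. max (pabs (riemann_sum p \<mu> \<phi> n - ?I)) (pabs (riemann_sum p \<mu> \<phi>' n - ?I')))
      \<longlonglongrightarrow> max 0 0"
    using riemann_sum_tendsto[OF \<mu>] assms(2,3)
    by (intro tendsto_max) (simp_all add: tendsto_iff_pabs[symmetric])
  then have lim: "(\<lambda>n. max (pabs (riemann_sum p \<mu> \<phi> n - ?I)) (pabs (riemann_sum p \<mu> \<phi>' n - ?I')))
      \<longlonglongrightarrow> 0" by simp
  have le: "norm (pabs (riemann_sum p \<mu> (\<lambda>x. \<phi> x + \<phi>' x) n - (?I + ?I'))) \<le>
      max (pabs (riemann_sum p \<mu> \<phi> n - ?I)) (pabs (riemann_sum p \<mu> \<phi>' n - ?I'))" for n
    using pabs_add[of "riemann_sum p \<mu> \<phi> n - ?I" "riemann_sum p \<mu> \<phi>' n - ?I'"]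
    by (simp add: riemann_sum_def sum.distrib algebra_simps pabs_nonneg)
  have "riemann_sum p \<mu> (\<lambda>x. \<phi> x + \<phi>' x) \<longlonglongrightarrow> ?I + ?I'"
    unfolding tendsto_iff_pabs[of _ "?I + ?I'"]
    by (rule Lim_null_comparison[OF always_eventually lim]) (rule allI, rule le)
  then show ?thesis
    by (simp add: measure_integral_def[of p \<mu> "\<lambda>x. \<phi> x + \<phi>' x"] limI)
qed

theorem measure_integral_cmult:
  assumes \<mu>: "\<mu> \<in> iwasawa_algebra p (L :: 'c set)" and "continuous_on Zp_units \<phi>"
  shows "measure_integral p \<mu> (\<lambda>x. c * \<phi> x) = c * measure_integral p \<mu> \<phi>"
proof -
  let ?I = "measure_integral p \<mu> \<phi>"
  have "(\<lambda>n. pabs c * pabs (riemann_sum p \<mu> \<phi> n - ?I)) \<longlonglongrightarrow> pabs c * 0"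
    using riemann_sum_tendsto[OF assms]
    by (intro tendsto_mult tendsto_const) (simp add: tendsto_iff_pabs[symmetric])
  moreover have "pabs c * pabs (riemann_sum p \<mu> \<phi> n - ?I) =
      pabs (riemann_sum p \<mu> (\<lambda>x. c * \<phi> x) n - c * ?I)" for n
    by (simp add: riemann_sum_def sum_distrib_left pabs_mult[symmetric] algebra_simps)
  ultimately have "riemann_sum p \<mu> (\<lambda>x. c * \<phi> x) \<longlonglongrightarrow> c * ?I"
    by (simp add: tendsto_iff_pabs[of _ "c * ?I"])
  then show ?thesis
    by (simp add: measure_integral_def[of p \<mu> "\<lambda>x. c * \<phi> x"] limI)
qed

theorem pabs_measure_integral_le:
  assumes \<mu>: "\<mu> \<in> iwasawa_algebra p (L :: 'c set)" and "continuous_on Zp_units \<phi>"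
    and C: "\<And>x. x \<in> Zp_units \<Longrightarrow> pabs (\<phi> x) \<le> C"
  shows "pabs (measure_integral p \<mu> \<phi>) \<le> C"
proof (rule tendsto_upperbound)
  show "(\<lambda>n. pabs (riemann_sum p \<mu> \<phi> n)) \<longlonglongrightarrow> pabs (measure_integral p \<mu> \<phi>)"
    unfolding pabs_def by (intro tendsto_intros riemann_sum_tendsto[OF assms(1,2)])
  have "(1 :: 'c) \<in> Zp_units"
    using of_nat_in_Zp_units[of 1 1] p_gt_1 by (simp add: in_totatives_iff)
  then have "C \<ge> 0"
    using C[of 1] pabs_nonneg[of "\<phi> 1"] by simp
  have "pabs (riemann_sum p \<mu> \<phi> n) \<le> C" if "n > 0" for n
    unfolding riemann_sum_def
  proof (intro pabs_sum_le \<open>C \<ge> 0\<close>)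
    fix a assume a: "a \<in> totatives (p ^ n)"
    have "pabs (\<mu> n a) \<le> 1"
      using \<mu> a unfolding iwasawa_algebra_def ring_of_integers_def by blast
    then show "pabs (\<phi> (of_nat a) * \<mu> n a) \<le> C"
      using C[OF of_nat_in_Zp_units[OF a that]] \<open>C \<ge> 0\<close>
        mult_mono[of "pabs (\<phi> (of_nat a))" C "pabs (\<mu> n a)" 1]
      by (simp add: pabs_mult pabs_nonneg)
  qed
  then show "\<forall>\<^sub>F n in sequentially. pabs (riemann_sum p \<mu> \<phi> n) \<le> C"
    using eventually_gt_at_top[of 0] by (rule eventually_mono[rotated])
qed simp

theorem measure_integral_coset:
  assumes \<mu>: "\<mu> \<in> iwasawa_algebra p (L :: 'c set)" and b: "b \<in> totatives (p ^ n)"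
  shows "measure_integral p \<mu> (\<lambda>x. if pabs (x - of_nat b) \<le> 1 / real p ^ n then 1 else 0) = \<mu> n b"
proof -
  have ind: "pabs (of_nat a - of_nat b :: 'c) \<le> 1 / real p ^ n \<longleftrightarrow> [a = b] (mod p ^ n)" for a
    using pabs_of_int_le_iff[of "int a - int b" n]
    by (simp add: cong_int_iff[symmetric] cong_iff_dvd_diff)
  have *: "(\<Sum>a | a \<in> totatives (p ^ m) \<and> [a = b] (mod p ^ n). \<mu> m a) = \<mu> n b" if "m \<ge> n" for m
    using that
  proof (induction m rule: dec_induct)
    case base
    have "{a \<in> totatives (p ^ n). [a = b] (mod p ^ n)} = {b}"
    proof -
      have "a = b" if "a \<in> totatives (p ^ n)" "[a = b] (mod p ^ n)" for a
        using totative_mod_eq_iff[OF that(1), of a] totative_mod_eq_iff[OF b, of a] that(2) by auto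
      then show ?thesis using b by auto
    qed
    then show ?case by simp
  next
    case (step m)
    let ?f = "\<lambda>a. if [a = b] (mod p ^ n) then \<mu> (Suc m) a else 0"
    have "(\<Sum>a | a \<in> totatives (p ^ Suc m) \<and> [a = b] (mod p ^ n). \<mu> (Suc m) a) =
        (\<Sum>a\<in>totatives (p ^ Suc m). ?f a)"
      by (simp add: sum.inter_filter del: power_Suc)
    also have "\<dots> = (\<Sum>c\<in>totatives (p ^ m).
        \<Sum>a | a \<in> totatives (p ^ Suc m) \<and> [a = c] (mod p ^ m). ?f a)"
      by (rule sum_totatives_regroup[symmetric])
    also have "\<dots> = (\<Sum>c\<in>totatives (p ^ m). if [c = b] (mod p ^ n) then \<mu> m c else 0)"
    proof (intro sum.cong refl)
      fix c assume c: "c \<in> totatives (p ^ m)"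
      have iff: "[a = b] (mod p ^ n) \<longleftrightarrow> [c = b] (mod p ^ n)" if "[a = c] (mod p ^ m)" for a
        using cong_dvd_modulus_nat[OF that le_imp_power_dvd[OF step.hyps(1)]]
        by (meson cong_sym cong_trans)
      have "(\<Sum>a | a \<in> totatives (p ^ Suc m) \<and> [a = c] (mod p ^ m). ?f a) =
          (\<Sum>a | a \<in> totatives (p ^ Suc m) \<and> [a = c] (mod p ^ m).
             if [c = b] (mod p ^ n) then \<mu> (Suc m) a else 0)"
      proof (intro sum.cong refl)
        fix a assume "a \<in> {a \<in> totatives (p ^ Suc m). [a = c] (mod p ^ m)}"
        then show "?f a = (if [c = b] (mod p ^ n) then \<mu> (Suc m) a else 0)"
          using iff[of a] by (simp del: power_Suc)
      qed
      also have "\<dots> = (if [c = b] (mod p ^ n) then \<mu> m c else 0)"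
        using \<mu> c by (auto simp: iwasawa_algebra_def simp del: power_Suc)
      finally show "(\<Sum>a | a \<in> totatives (p ^ Suc m) \<and> [a = c] (mod p ^ m). ?f a) =
          (if [c = b] (mod p ^ n) then \<mu> m c else 0)" .
    qed
    also have "\<dots> = (\<Sum>a | a \<in> totatives (p ^ m) \<and> [a = b] (mod p ^ n). \<mu> m a)"
      by (simp add: sum.inter_filter)
    finally show ?case
      using step.IH by simp
  qed
  have "riemann_sum p \<mu> (\<lambda>x. if pabs (x - of_nat b) \<le> 1 / real p ^ n then 1 else 0) m = \<mu> n b"
    if "m \<ge> n" for m
    using *[OF that] by (simp add: riemann_sum_def ind sum.inter_filter if_distrib[of "\<lambda>c. c * _"] cong: if_cong)
  then have "\<forall>\<^sub>F m in sequentially.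
      riemann_sum p \<mu> (\<lambda>x. if pabs (x - of_nat b) \<le> 1 / real p ^ n then 1 else 0) m = \<mu> n b"
    by (auto simp: eventually_sequentially)
  then show ?thesis
    unfolding measure_integral_def by (intro limI tendsto_eventually)
qed

end

end

theory Submission
  imports Defs
begin

text \<open>
  For a sequence \<open>g\<close> that is periodic with sum zero over a period, iterated summation by parts
  continues \<open>\<Sum> g n / n ^ s\<close> to all \<open>s\<close> and expresses the value at \<open>1 - k\<close> by finitely many boundary
  terms, over any field of characteristic 0. The same boundary terms give the linear coefficient of
  the polynomial \<open>t \<mapsto> \<Sum>m\<le>t N. g m * m ^ k\<close>, so these values are p-adic limits of power sums divided by
  \<open>t N\<close>. The regularized values at 0 of \<open>\<eta>\<close> restricted to the residue classes modulo \<open>p ^ m\<close> form a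
  measure, and expanding \<open>(a + p ^ m j) ^ k\<close> to first order identifies its twisted moments with the
  Euler-factor-corrected L-values; multiplying it by \<open>1 / x\<close> shifts the exponent and yields \<open>\<zeta>\<close>.
  Uniqueness needs only the trivial character: indicator functions of cosets are uniform limits on the
  units of polynomials without constant term.
\<close>

section \<open>Iterated summation by parts against a periodic sequence\<close>

text \<open>The zero sum of the sequence over a period is the whole regularization: it removes the
  pole at s = 1, and it survives restriction to progressions of step p^m because D is prime to p. It
  also explains the mass of a class. Summing the Hurwitz value zeta(0, x) = 1/2 - x over x = (a +
  p^m j) / (p^m D) with weights h (a + p^m j), everything independent of j cancels and - h (a + p^m
  j) * j / D remains, with no power of p in the denominator; this is why the measure is bounded.
  L-values and integrals live in the unrelated fields \<open>complex\<close> and \<open>'c\<close>.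
  They are compared in \<open>rat alg_closure\<close>: a regularized value is a rational expression
  in the values of the sequence, hence commutes with both embeddings. \<open>dirichlet_L\<close> is
  a choice among continuations, so nothing can be said about it until one continuation has been
  constructed. Masses that are values at 0 attach L(1 - k) to the moment of x^(k-1), whereas the
  theorem attaches it to x^k; hence the factor 1/x.\<close>

definition fdiff :: "(nat \<Rightarrow> 'a::ab_group_add) \<Rightarrow> nat \<Rightarrow> 'a" where
  "fdiff u n = u (Suc n) - u n"

lemma fdiff_pow_Suc: "(fdiff ^^ Suc r) u n = (fdiff ^^ r) u (Suc n) - (fdiff ^^ r) u n"
  by (simp add: fdiff_def)

lemma sum_by_parts:
  fixes H u :: "nat \<Rightarrow> 'a::comm_ring_1"
  shows "(\<Sum>m=1..n. (H m - H (m - 1)) * u m) =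
    H n * u (Suc n) - H 0 * u 1 - (\<Sum>m=1..n. H m * fdiff u m)"
  by (induction n) (auto simp: fdiff_def algebra_simps)

text \<open>Partial sums are determined up to a constant; subtracting their mean over a period
  selects the one that again has zero sum, so that the operation can be iterated.\<close>

definition antidiff :: "nat \<Rightarrow> (nat \<Rightarrow> 'a::field_char_0) \<Rightarrow> nat \<Rightarrow> 'a" where
  "antidiff N g n = (\<Sum>m=1..n. g m) - (\<Sum>l<N. \<Sum>m=1..l. g m) / of_nat N"

abbreviation iter_antidiff :: "nat \<Rightarrow> (nat \<Rightarrow> 'a::field_char_0) \<Rightarrow> nat \<Rightarrow> nat \<Rightarrow> 'a" where
  "iter_antidiff N g i \<equiv> (antidiff N ^^ i) g"

definition zero_sum_periodic :: "nat \<Rightarrow> (nat \<Rightarrow> 'a::field_char_0) \<Rightarrow> bool" where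
  "zero_sum_periodic N g \<longleftrightarrow> N > 0 \<and> (\<forall>n. g (n + N) = g n) \<and> (\<Sum>n<N. g n) = 0"

lemma periodic_sum_shift:
  fixes g :: "nat \<Rightarrow> 'a::ab_group_add"
  assumes "\<And>n. g (n + N) = g n"
  shows "(\<Sum>i<N. g (n + i)) = (\<Sum>i<N. g i)"
proof (induction n)
  case (Suc n)
  have "(\<Sum>i<N. g (Suc n + i)) + g n = (\<Sum>i<Suc N. g (n + i))"
    by (subst sum.lessThan_Suc_shift) (simp add: add.commute)
  also have "\<dots> = (\<Sum>i<N. g (n + i)) + g n"
    using assms[of n] by simp
  finally show ?case
    using Suc by simp
qed simp

lemma antidiff_diff:
  assumes "m > 0"
  shows "antidiff N g m - antidiff N g (m - 1) = g m"
  using assms by (cases m) (auto simp: antidiff_def)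

text \<open>The zero sum of g makes its partial sums periodic; the subtracted mean gives the result
  zero sum.\<close>

lemma zero_sum_periodic_antidiff:
  assumes "zero_sum_periodic N g"
  shows "zero_sum_periodic N (antidiff N g)"
  unfolding zero_sum_periodic_def
proof (intro conjI allI)
  have N: "N > 0" and per: "\<And>n. g (n + N) = g n" and zero: "(\<Sum>n<N. g n) = 0"
    using assms by (auto simp: zero_sum_periodic_def)
  show "N > 0" by (rule N)
  show "antidiff N g (n + N) = antidiff N g n" for n
  proof -
    have "(\<Sum>m=1..n+N. g m) = (\<Sum>m=1..n. g m) + (\<Sum>i<N. g (Suc n + i))"
      by (induction N) (auto simp: algebra_simps)
    also have "(\<Sum>i<N. g (Suc n + i)) = 0"
      using periodic_sum_shift[of g N "Suc n", OF per] zero by simp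
    finally show ?thesis by (simp add: antidiff_def)
  qed
  show "(\<Sum>n<N. antidiff N g n) = 0"
    using N by (simp add: antidiff_def sum_subtractf)
qed

lemma zero_sum_periodic_iter:
  assumes "zero_sum_periodic N g"
  shows "zero_sum_periodic N (iter_antidiff N g i)"
  by (induction i) (auto simp: assms zero_sum_periodic_antidiff)

lemma zero_sum_periodic_mult:
  assumes "zero_sum_periodic N g"
  shows "g (t * N) = g 0"
proof (induction t)
  case (Suc t)
  then show ?case
    using assms unfolding zero_sum_periodic_def by (metis add.commute mult_Suc)
qed simp

lemma zero_sum_periodic_mod:
  assumes "zero_sum_periodic N g"
  shows "g n = g (n mod N)"
proof -
  have "g (a + t * N) = g a" for a t
  proof (induction t)
    case (Suc t)
    then show ?case
      using assms unfolding zero_sum_periodic_def by (metis add.assoc add.commute mult_Suc)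
  qed simp
  from this[of "n mod N" "n div N"] show ?thesis
    by (simp add: mult.commute)
qed

definition boundary :: "nat \<Rightarrow> (nat \<Rightarrow> 'a::field_char_0) \<Rightarrow> nat \<Rightarrow> (nat \<Rightarrow> 'a) \<Rightarrow> nat \<Rightarrow> 'a" where
  "boundary N g r u n =
     (\<Sum>i<r. (- 1) ^ i * iter_antidiff N g (Suc i) n * (fdiff ^^ i) u (Suc n))"

lemma iterated_sum_by_parts:
  "(\<Sum>m=1..n. g m * u m) = boundary N g r u n - boundary N g r u 0 +
     (- 1) ^ r * (\<Sum>m=1..n. iter_antidiff N g r m * (fdiff ^^ r) u m)"
proof (induction r)
  case (Suc r)
  let ?G = "iter_antidiff N g" and ?u = "(fdiff ^^ r) u"
  have "(\<Sum>m=1..n. ?G r m * ?u m) = (\<Sum>m=1..n. (?G (Suc r) m - ?G (Suc r) (m - 1)) * ?u m)"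
    by (intro sum.cong) (simp_all add: antidiff_diff[simplified])
  also have "\<dots> = ?G (Suc r) n * ?u (Suc n) - ?G (Suc r) 0 * ?u 1
      - (\<Sum>m=1..n. ?G (Suc r) m * fdiff ?u m)"
    by (rule sum_by_parts)
  finally have *: "(\<Sum>m=1..n. ?G r m * ?u m) = ?G (Suc r) n * ?u (Suc n) - ?G (Suc r) 0 * ?u 1
      - (\<Sum>m=1..n. ?G (Suc r) m * (fdiff ^^ Suc r) u m)" by simp
  have "(\<Sum>m=1..n. g m * u m) = boundary N g r u n - boundary N g r u 0 +
      (- 1) ^ r * (\<Sum>m=1..n. ?G r m * ?u m)"
    by (rule Suc.IH)
  also have "\<dots> = boundary N g (Suc r) u n - boundary N g (Suc r) u 0 +
     (- 1) ^ Suc r * (\<Sum>m=1..n. ?G (Suc r) m * (fdiff ^^ Suc r) u m)"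
    unfolding * boundary_def by (simp add: algebra_simps del: funpow.simps)
  finally show ?case .
qed (simp add: boundary_def)

text \<open>
  The value at \<open>1 - k\<close> of the continuation of \<open>\<Sum>n\<ge>1. g n / n ^ s\<close>: differencing \<open>n ^ (k - 1)\<close> often
  enough kills the sum, and only the boundary terms of the summation by parts remain.
\<close>

definition regularized_value :: "nat \<Rightarrow> (nat \<Rightarrow> 'a::field_char_0) \<Rightarrow> nat \<Rightarrow> 'a" where
  "regularized_value N g k = - boundary N g (Suc k) (\<lambda>n. of_nat n ^ (k - 1)) 0"

section \<open>Compatibility with field embeddings\<close>

lemma field_embedding_simps:
  assumes "field_embedding h"
  shows "h 0 = 0" "h 1 = 1" "h (x + y) = h x + h y" "h (- x) = - h x" "h (x - y) = h x - h y"
    "h (x * y) = h x * h y" "h (sum f A) = (\<Sum>i\<in>A. h (f i))" "h (x ^ n) = h x ^ n"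
    "h (of_nat m) = of_nat m" "h (inverse x) = inverse (h x)" "h (x / y) = h x / h y"
proof -
  have 1: "h 1 = 1" and add: "h (x + y) = h x + h y" and mult: "h (x * y) = h x * h y" for x y
    using assms unfolding field_embedding_def by blast+
  show 0: "h 0 = 0" using add[of 0 0] by (metis add_0 add_cancel_right_right)
  have minus: "h (- x) = - h x" for x
    using add[of x "- x"] 0 by (simp add: eq_neg_iff_add_eq_0 add.commute)
  show "h 1 = 1" "h (x + y) = h x + h y" "h (- x) = - h x" "h (x * y) = h x * h y"
    by (fact 1 add minus mult)+
  show "h (x - y) = h x - h y" using add[of x "- y"] minus[of y] by simp
  show "h (sum f A) = (\<Sum>i\<in>A. h (f i))"
    by (induction A rule: infinite_finite_induct) (simp_all add: 0 add)
  show "h (x ^ n) = h x ^ n" by (induction n) (simp_all add: 1 mult)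
  show "h (of_nat m) = of_nat m" by (induction m) (simp_all add: 0 1 add)
  have inv: "h (inverse x) = inverse (h x)" for x
  proof (cases "x = 0")
    case False
    then have "h x * h (inverse x) = 1" using mult[of x "inverse x"] 1 by simp
    then show ?thesis by (simp add: inverse_unique)
  qed (simp add: 0)
  show "h (inverse x) = inverse (h x)" by (rule inv)
  show "h (x / y) = h x / h y" by (simp add: divide_inverse mult inv)
qed

lemma field_embedding_eq_0_iff:
  assumes "field_embedding h"
  shows "h x = 0 \<longleftrightarrow> x = 0"
proof
  assume "h x = 0"
  show "x = 0"
  proof (rule ccontr)
    assume "x \<noteq> 0"
    then have "h x * h (inverse x) = 1"
      using field_embedding_simps(2,6)[OF assms] by (metis right_inverse)
    with \<open>h x = 0\<close> show False by simp
  qed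
qed (simp add: field_embedding_simps[OF assms])

lemma field_embedding_inj:
  assumes "field_embedding h" "h x = h y"
  shows "x = y"
  using field_embedding_eq_0_iff[OF assms(1), of "x - y"] assms
  by (simp add: field_embedding_simps[OF assms(1)])

lemma field_embedding_fdiff:
  assumes "field_embedding h"
  shows "h ((fdiff ^^ r) u n) = (fdiff ^^ r) (\<lambda>n. h (u n)) n"
  by (induction r arbitrary: n) (simp_all add: fdiff_def field_embedding_simps[OF assms])

lemma field_embedding_iter_antidiff:
  assumes "field_embedding h"
  shows "h (iter_antidiff N g i n) = iter_antidiff N (\<lambda>n. h (g n)) i n"
  by (induction i arbitrary: n) (simp_all add: antidiff_def field_embedding_simps[OF assms])

text \<open>This is the bridge between the two completions: a complex L-value and a p-adic moment
  become images of one algebraic number.\<close>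

lemma field_embedding_regularized_value:
  assumes "field_embedding h"
  shows "h (regularized_value N g k) = regularized_value N (\<lambda>n. h (g n)) k"
  by (simp add: regularized_value_def boundary_def field_embedding_simps[OF assms]
      field_embedding_fdiff[OF assms] field_embedding_iter_antidiff[OF assms] del: funpow.simps)

lemma field_embedding_zero_sum_periodic:
  assumes "field_embedding h" "zero_sum_periodic N g"
  shows "zero_sum_periodic N (\<lambda>n. h (g n))"
  using assms(2) field_embedding_simps(7)[OF assms(1), of g "{..<N}"]
  by (auto simp: zero_sum_periodic_def field_embedding_simps(1)[OF assms(1)])


section \<open>Power sums weighted by a periodic sequence\<close>

text \<open>The forward difference on polynomials instead of sequences, where it can be compared
  with the derivative.\<close>

definition poly_fdiff :: "'a::comm_ring_1 poly \<Rightarrow> 'a poly" where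
  "poly_fdiff q = pcompose q [:1, 1:] - q"

lemma poly_fdiff_pow: "poly ((poly_fdiff ^^ r) q) (of_nat n) = (fdiff ^^ r) (\<lambda>n. poly q (of_nat n)) n"
proof (induction r arbitrary: n)
  case (Suc r)
  then show ?case
    using Suc[of "Suc n"] by (simp add: poly_fdiff_def fdiff_def poly_pcompose)
qed simp

lemma pderiv_poly_fdiff: 
  "pderiv ((poly_fdiff ^^ r) q) = (poly_fdiff ^^ r) (pderiv (q :: 'a::field_char_0 poly))"
  by (induction r) (simp_all add: poly_fdiff_def pderiv_diff pderiv_pcompose pderiv_pCons)

lemma degree_poly_fdiff_less:
  "poly_fdiff (q :: 'a::field_char_0 poly) = 0 \<or> degree (poly_fdiff q) < degree q"
proof (cases "degree q = 0")
  case True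
  then obtain c where "q = [:c:]" by (meson degree_eq_zeroE)
  then show ?thesis by (simp add: poly_fdiff_def)
next
  case False
  have d: "degree (pcompose q [:1, 1:]) = degree q" by (simp add: degree_pcompose)
  have "coeff (pcompose q [:1, 1:]) (degree q) = coeff q (degree q)"
    using lead_coeff_comp[of "[:1, 1:]" q] d by simp
  then have "coeff (poly_fdiff q) (degree q) = 0" by (simp add: poly_fdiff_def)
  moreover have "degree (poly_fdiff q) \<le> degree q"
    unfolding poly_fdiff_def by (rule degree_diff_le) (simp_all add: d)
  ultimately show ?thesis
    using False by (metis degree_0 eq_zero_or_degree_less gr0I)
qed

lemma poly_fdiff_pow_eq_0:
  assumes "degree (q :: 'a::field_char_0 poly) < r"
  shows "(poly_fdiff ^^ r) q = 0"
  using assms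
proof (induction r arbitrary: q)
  case (Suc r)
  have zero: "(poly_fdiff ^^ r) 0 = (0 :: 'a poly)"
    by (induction r) (simp_all add: poly_fdiff_def)
  show ?case
    using degree_poly_fdiff_less[of q] Suc.IH[of "poly_fdiff q"] Suc.prems zero
    by (auto simp: funpow_Suc_right simp del: funpow.simps)
qed simp

lemma fdiff_pow_power_eq_0:
  assumes "j < r"
  shows "(fdiff ^^ r) (\<lambda>n. of_nat n ^ j :: 'a::field_char_0) n = 0"
  using poly_fdiff_pow[of r "monom 1 j :: 'a poly" n] poly_fdiff_pow_eq_0[of "monom 1 j :: 'a poly" r]
    assms by (simp add: poly_monom degree_monom_eq)

text \<open>
  The boundary term is a polynomial in \<open>t * N\<close>, and forming it commutes with differentiation; this
  turns the linear coefficient of the power sum into the regularized value one degree lower.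
\<close>

lemma periodic_power_sum:
  fixes g :: "nat \<Rightarrow> 'a::field_char_0"
  assumes g: "zero_sum_periodic N g" and "k > 0"
  obtains Q where "\<And>t. (\<Sum>m=1..t * N. g m * of_nat m ^ k) = of_nat (t * N) * poly Q (of_nat (t * N))"
    and "poly Q 0 = - of_nat k * regularized_value N g k"
proof -
  define c where "c = (\<lambda>i. (- 1) ^ i * iter_antidiff N g (Suc i) 0)"
  \<comment> \<open>\<open>B q\<close> interpolates the boundary term at the multiples of N: there
    the periodic factors all equal their value \<open>c i\<close> at 0. Composition with
    \<open>[:1, 1:]\<close> accounts for the argument \<open>Suc n\<close>.\<close>
  define B where "B = (\<lambda>q. \<Sum>i<Suc k. smult (c i) (pcompose ((poly_fdiff ^^ i) q) [:1, 1:]))"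
  have B: "poly (B q) (of_nat n) = (\<Sum>i<Suc k. c i * (fdiff ^^ i) (\<lambda>n. poly q (of_nat n)) (Suc n))"
    for q n
    unfolding B_def poly_sum poly_smult poly_pcompose poly_fdiff_pow[symmetric] by simp
  have bd: "boundary N g (Suc k) (\<lambda>n. poly q (of_nat n)) (t * N) = poly (B q) (of_nat (t * N))" for q t
    unfolding B boundary_def c_def
    by (intro sum.cong refl) (simp only: zero_sum_periodic_mult[OF zero_sum_periodic_iter[OF g]])
  \<comment> \<open>The order \<open>Suc k\<close> is just enough to annihilate n^k; keeping the
    same order in \<open>regularized_value\<close>, where n^(k-1) needs fewer differences, lets the
    derivative of P match it term by term.\<close>
  define P where "P = B (monom 1 k)"
  \<comment> \<open>The power sum is P(x) - P(0) = x * Q(x) at x = t N, and Q(0) is the derivative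
    of P at 0.\<close>
  obtain a Q where P: "P = pCons a Q" by (cases P)
  show ?thesis
  proof
    fix t
    have "(\<Sum>m=1..t * N. g m * of_nat m ^ k) = (\<Sum>m=1..t * N. g m * poly (monom 1 k) (of_nat m))"
      by (simp add: poly_monom)
    also have "\<dots> = boundary N g (Suc k) (\<lambda>n. poly (monom 1 k) (of_nat n)) (t * N) -
        boundary N g (Suc k) (\<lambda>n. poly (monom 1 k) (of_nat n)) (0 * N)"
      by (subst iterated_sum_by_parts[of _ _ _ N "Suc k"])
         (simp add: poly_monom fdiff_pow_power_eq_0 del: funpow.simps)
    also have "\<dots> = poly P (of_nat (t * N)) - poly P 0"
      unfolding bd P_def by simp
    finally show "(\<Sum>m=1..t * N. g m * of_nat m ^ k) = of_nat (t * N) * poly Q (of_nat (t * N))"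
      by (simp add: P)
  next
    have scale: "(fdiff ^^ i) (\<lambda>n. of_nat k * v n) n = of_nat k * (fdiff ^^ i) v n"
      for i n and v :: "nat \<Rightarrow> 'a"
      by (induction i arbitrary: n) (simp_all add: fdiff_def algebra_simps)
    have "pderiv P = B (pderiv (monom 1 k))"
      unfolding P_def B_def
      by (simp add: higher_pderiv_sum[where n = 1, simplified] pderiv_smult pderiv_pcompose pderiv_poly_fdiff pderiv_pCons
          del: funpow.simps sum.lessThan_Suc)
    then have "poly (pderiv P) 0 = poly (B (monom (of_nat k) (k - 1))) (of_nat 0)"
      by (simp add: pderiv_monom)
    also have "\<dots> = (\<Sum>i<Suc k. c i * (fdiff ^^ i) (\<lambda>n. of_nat k * of_nat n ^ (k - 1)) 1)"
      unfolding B by (simp add: poly_monom del: funpow.simps sum.lessThan_Suc)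
    also have "(\<Sum>i<Suc k. c i * (fdiff ^^ i) (\<lambda>n. of_nat k * of_nat n ^ (k - 1)) 1) =
        - of_nat k * regularized_value N g k"
      unfolding regularized_value_def boundary_def c_def scale
      by (simp add: sum_distrib_left sum_negf mult_ac del: funpow.simps sum.lessThan_Suc)
    finally show "poly Q 0 = - of_nat k * regularized_value N g k"
      by (simp add: P pderiv_pCons)
  qed
qed


section \<open>Analytic continuation of Dirichlet series with periodic coefficients\<close>

text \<open>The mean value inequality applied r times: the r-th difference at n is controlled by the
  r-th derivative on the real ray from n. \<open>U\<close> is a function together with its
  successive derivatives.\<close>

lemma norm_fdiff_pow_le:
  fixes U :: "nat \<Rightarrow> complex \<Rightarrow> complex"
  assumes "\<And>j z. Re z > 0 \<Longrightarrow> (U j has_field_derivative U (Suc j) z) (at z)"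
    and "\<And>z. Im z = 0 \<Longrightarrow> Re z \<ge> real n \<Longrightarrow> norm (U r z) \<le> C" and "n > 0"
  shows "norm ((fdiff ^^ r) (\<lambda>n. U 0 (of_nat n)) n) \<le> C"
  using assms(1,2)
proof (induction r arbitrary: U)
  case (Suc r)
  \<comment> \<open>The unit-step difference of the family is again a family of successive
    derivatives, so the induction hypothesis applies to \<open>V\<close>.\<close>
  define V where "V = (\<lambda>j z. U j (z + 1) - U j z)"
  have V: "(V j has_field_derivative V (Suc j) z) (at z)" if "Re z > 0" for j z
  proof -
    have "(U j has_field_derivative U (Suc j) (z + 1)) (at (z + 1))"
      using that by (intro Suc.prems(1)) simp
    then have "((\<lambda>z. U j (z + 1)) has_field_derivative U (Suc j) (z + 1)) (at z)"
      by (rule DERIV_shift[THEN iffD1])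
    then show ?thesis
      unfolding V_def using that by (intro DERIV_diff Suc.prems(1))
  qed
  have "norm (V r z) \<le> C" if z: "Im z = 0" "Re z \<ge> real n" for z
  proof -
    define S where "S = {w. Im w = 0 \<and> Re w \<ge> real n}"
    have S: "S = {w. inner \<i> w = 0} \<inter> {w. Re w \<ge> real n}"
      by (auto simp: S_def inner_complex_def)
    have "convex S"
      unfolding S by (rule convex_Int[OF convex_hyperplane convex_halfspace_Re_ge])
    then have "norm (U r (z + 1) - U r z) \<le> C * norm (z + 1 - z)"
    proof (rule field_differentiable_bound[where f = "U r" and f' = "U (Suc r)"
        and x = "z + 1" and y = z])
      show "(U r has_field_derivative U (Suc r) w) (at w within S)" if "w \<in> S" for w
        using that \<open>n > 0\<close>
        by (intro has_field_derivative_at_within[OF Suc.prems(1)]) (simp add: S_def)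
      show "norm (U (Suc r) w) \<le> C" if "w \<in> S" for w
        using that by (intro Suc.prems(2)) (auto simp: S_def)
    qed (use z in \<open>auto simp: S_def\<close>)
    then show ?thesis by (simp add: V_def)
  qed
  from Suc.IH[of V, OF V this] have "norm ((fdiff ^^ r) (\<lambda>n. V 0 (of_nat n)) n) \<le> C" .
  moreover have "fdiff (\<lambda>n. U 0 (of_nat n)) = (\<lambda>n. V 0 (of_nat n))"
    by (auto simp: fdiff_def V_def add.commute)
  ultimately show ?case
    by (simp add: funpow_Suc_right del: funpow.simps)
qed auto

abbreviation npow :: "complex \<Rightarrow> nat \<Rightarrow> complex" where
  "npow s n \<equiv> of_nat n powr (- s)"

text \<open>The r-th derivative of z^(-s) is a product of r factors of norm at most
  \<open>norm s + real r\<close>, times z^(-s-r). Each difference thus gains a factor 1/n; the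
  condition on Re s makes the power decrease along the ray.\<close>

lemma norm_fdiff_npow_le:
  assumes "n > 0" and "Re s + real r \<ge> 0"
  shows "norm ((fdiff ^^ r) (npow s) n) \<le> (norm s + real r) ^ r * real n powr (- Re s - real r)"
proof -
  define U where "U = (\<lambda>j z. (\<Prod>i<j. - s - of_nat i) * z powr (- s - of_nat j))"
  have "norm ((fdiff ^^ r) (\<lambda>n. U 0 (of_nat n)) n) \<le>
      (norm s + real r) ^ r * real n powr (- Re s - real r)"
  proof (rule norm_fdiff_pow_le[OF _ _ \<open>n > 0\<close>])
    show "(U j has_field_derivative U (Suc j) z) (at z)" if "Re z > 0" for j z
    proof -
      have "z \<notin> \<real>\<^sub>\<le>\<^sub>0" using that by (auto simp: complex_nonpos_Reals_iff)
      then have "(U j has_field_derivative (\<Prod>i<j. - s - of_nat i) *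
          ((- s - of_nat j) * z powr (- s - of_nat j - 1))) (at z)"
        unfolding U_def by (intro DERIV_cmult has_field_derivative_powr)
      then show ?thesis by (simp add: U_def mult.assoc diff_diff_eq add.commute)
    qed
  next
    fix z :: complex assume z: "Im z = 0" "Re z \<ge> real n"
    have "norm (z powr (- s - of_nat r)) = Re z powr (- Re s - real r)"
      using z by (subst norm_powr_real_powr) (auto simp: complex_is_Real_iff)
    also have "\<dots> \<le> real n powr (- Re s - real r)"
      using z assms by (intro powr_mono2') auto
    finally have 1: "norm (z powr (- s - of_nat r)) \<le> real n powr (- Re s - real r)" .
    have "norm (\<Prod>i<r. - s - of_nat i) \<le> (\<Prod>i<r. norm s + real r)"
      unfolding prod_norm[symmetric]
    proof (intro prod_mono conjI)
      fix i assume "i \<in> {..<r}"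
      have "norm (- s - of_nat i) \<le> norm (- s) + norm (of_nat i :: complex)"
        by (rule norm_triangle_ineq4)
      also have "\<dots> \<le> norm s + real r" using \<open>i \<in> {..<r}\<close> by simp
      finally show "norm (- s - of_nat i) \<le> norm s + real r" .
    qed auto
    with 1 show "norm (U r z) \<le> (norm s + real r) ^ r * real n powr (- Re s - real r)"
      unfolding U_def norm_mult by (intro mult_mono) auto
  qed
  then show ?thesis by (simp add: U_def)
qed

lemma fdiff_npow_holomorphic:
  "n > 0 \<Longrightarrow> (\<lambda>s. (fdiff ^^ r) (npow s) n) holomorphic_on A"
proof (induction r arbitrary: n)
  case 0
  then show ?case by (auto intro!: holomorphic_intros)
next
  case (Suc r)
  then show ?case
    unfolding fdiff_pow_Suc by (intro holomorphic_on_diff Suc.IH) auto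
qed

lemma fdiff_pow_cong:
  assumes "\<And>m. m \<ge> n \<Longrightarrow> u m = v m"
  shows "(fdiff ^^ r) u n = (fdiff ^^ r) v n"
  using assms
proof (induction r arbitrary: n)
  case (Suc r)
  then show ?case
    unfolding fdiff_pow_Suc using Suc.IH[of n] Suc.IH[of "Suc n"] Suc.prems by simp
qed simp

lemma zero_sum_periodic_bounded:
  fixes g :: "nat \<Rightarrow> complex"
  assumes "zero_sum_periodic N g"
  obtains B where "B \<ge> 0" "\<And>n. norm (g n) \<le> B"
proof
  have "N > 0" using assms by (simp add: zero_sum_periodic_def)
  show "(\<Sum>n<N. norm (g n)) \<ge> 0" by (intro sum_nonneg) auto
  show "norm (g n) \<le> (\<Sum>n<N. norm (g n))" for n
    using member_le_sum[of "n mod N" "{..<N}" "\<lambda>n. norm (g n)"] \<open>N > 0\<close>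
      zero_sum_periodic_mod[OF assms, of n] by simp
qed

definition tail_term :: "nat \<Rightarrow> (nat \<Rightarrow> complex) \<Rightarrow> nat \<Rightarrow> complex \<Rightarrow> nat \<Rightarrow> complex" where
  "tail_term N g r s n = iter_antidiff N g r (Suc n) * (fdiff ^^ r) (npow s) (Suc n)"

text \<open>The limit of \<open>iterated_sum_by_parts\<close> for n to infinity, with the boundary
  term at infinity dropped. The tail converges for Re s > 1 - r, so larger r reaches further
  left.\<close>

definition continuation :: "nat \<Rightarrow> (nat \<Rightarrow> complex) \<Rightarrow> nat \<Rightarrow> complex \<Rightarrow> complex" where
  "continuation N g r s = - boundary N g r (npow s) 0 + (- 1) ^ r * (\<Sum>n. tail_term N g r s n)"

lemma tail_term_bound:
  assumes "zero_sum_periodic N g" "Re s0 > 1 - real r"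
  obtains d h where "d > 0" "summable h" "\<And>n. h n \<ge> 0"
    "\<And>s n. s \<in> ball s0 d \<Longrightarrow> norm (tail_term N g r s n) \<le> h n"
proof -
  obtain B where B: "B \<ge> 0" "\<And>n. norm (iter_antidiff N g r n) \<le> B"
    using zero_sum_periodic_bounded[OF zero_sum_periodic_iter[OF assms(1)]] by metis
  \<comment> \<open>Half the distance from s0 to the line Re s = 1 - r, so that the exponent
    \<open>e\<close> below equals -1 - d and the majorant is summable.\<close>
  define d where "d = (Re s0 - (1 - real r)) / 2"
  have d: "d > 0" using assms(2) by (simp add: d_def)
  define e where "e = - (Re s0 - d) - real r"
  have e: "e < - 1" using assms(2) by (simp add: e_def d_def field_simps)
  define C where "C = B * (norm s0 + d + real r) ^ r"
  have C: "C \<ge> 0" using B d by (simp add: C_def)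
  show ?thesis
  proof
    show "d > 0" by (rule d)
    have "summable (\<lambda>n. real n powr e)"
      using e by (simp add: summable_real_powr_iff)
    then show "summable (\<lambda>n. C * real (Suc n) powr e)"
      by (intro summable_mult) (subst summable_Suc_iff)
    show "C * real (Suc n) powr e \<ge> 0" for n using C by simp
    fix s n assume s: "s \<in> ball s0 d"
    have 1: "norm s \<le> norm s0 + d"
      using s norm_triangle_sub[of s s0] by (simp add: dist_norm norm_minus_commute)
    have "\<bar>Re (s0 - s)\<bar> \<le> norm (s0 - s)" by (rule abs_Re_le_cmod)
    with s have 2: "Re s > Re s0 - d" by (simp add: dist_norm)
    have 3: "Re s + real r \<ge> 0" using 2 e d unfolding e_def by linarith
    have "norm (tail_term N g r s n) \<le>
        B * ((norm s + real r) ^ r * real (Suc n) powr (- Re s - real r))"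
      unfolding tail_term_def norm_mult
      using B norm_fdiff_npow_le[OF _ 3, of "Suc n"] by (intro mult_mono) auto
    also have "\<dots> \<le> B * ((norm s0 + d + real r) ^ r * real (Suc n) powr e)"
      using 1 2 B d by (intro mult_left_mono mult_mono power_mono powr_mono) (auto simp: e_def)
    finally show "norm (tail_term N g r s n) \<le> C * real (Suc n) powr e"
      by (simp add: C_def mult.assoc)
  qed
qed

lemma summable_tail_term:
  assumes "zero_sum_periodic N g" "Re s > 1 - real r"
  shows "summable (tail_term N g r s)"
proof -
  obtain d h where "d > 0" "summable h" "\<And>s' n. s' \<in> ball s d \<Longrightarrow> norm (tail_term N g r s' n) \<le> h n"
    using tail_term_bound[OF assms] by metis
  then show ?thesis
    using summable_comparison_test'[of h 0 "tail_term N g r s"] by simp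
qed

lemma continuation_holomorphic:
  assumes "zero_sum_periodic N g"
  shows "continuation N g r holomorphic_on {s. Re s > 1 - real r}"
proof -
  define S where "S = {s. Re s > 1 - real r}"
  have S: "open S" unfolding S_def by (rule open_halfspace_Re_gt)
  have hol: "(\<lambda>s. tail_term N g r s n) holomorphic_on A" for n A
    unfolding tail_term_def by (intro holomorphic_intros fdiff_npow_holomorphic) auto
  have "\<exists>f f'. \<forall>s\<in>S. (\<lambda>n. tail_term N g r s n) sums f s \<and>
      (\<lambda>n. deriv (\<lambda>s. tail_term N g r s n) s) sums f' s \<and> (f has_field_derivative f' s) (at s)"
  proof (rule series_and_derivative_comparison_complex[OF S])
    show "((\<lambda>s. tail_term N g r s n) has_field_derivative deriv (\<lambda>s. tail_term N g r s n) s) (at s)"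
      if "s \<in> S" for n s
      using hol[of n UNIV] by (intro holomorphic_derivI[of _ UNIV]) auto
    fix s assume "s \<in> S"
    then have "Re s > 1 - real r" by (simp add: S_def)
    then obtain d h where h: "d > 0" "summable h" "\<And>n. h n \<ge> 0"
        "\<And>s' n. s' \<in> ball s d \<Longrightarrow> norm (tail_term N g r s' n) \<le> h n"
      using tail_term_bound[OF assms] by metis
    have "summable (\<lambda>n. complex_of_real (h n))" using h(2) by (rule summable_of_real)
    then show "\<exists>d h. 0 < d \<and> summable h \<and> range h \<subseteq> \<real>\<^sub>\<ge>\<^sub>0 \<and>
        (\<forall>\<^sub>F n in sequentially. \<forall>y\<in>ball s d \<inter> S. cmod (tail_term N g r y n) \<le> cmod (h n))"
      using h by (intro exI[of _ d] exI[of _ "\<lambda>n. complex_of_real (h n)"]) auto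
  qed
  then obtain f f' where f: "\<And>s. s \<in> S \<Longrightarrow> (\<lambda>n. tail_term N g r s n) sums f s"
      "\<And>s. s \<in> S \<Longrightarrow> (f has_field_derivative f' s) (at s)" by blast
  have hol_f: "f holomorphic_on S"
    using f(2) S unfolding holomorphic_on_open[OF S] by blast
  have hol_b: "(\<lambda>s. boundary N g r (npow s) 0) holomorphic_on S"
    unfolding boundary_def by (intro holomorphic_intros fdiff_npow_holomorphic) auto
  have "(\<lambda>s. - boundary N g r (npow s) 0 + (- 1) ^ r * f s) holomorphic_on S"
    by (intro holomorphic_on_add holomorphic_on_minus holomorphic_on_mult holomorphic_on_const hol_f hol_b)
  moreover have "- boundary N g r (npow s) 0 + (- 1) ^ r * f s = continuation N g r s" if "s \<in> S" for s
    using f(1)[OF that] by (simp add: continuation_def sums_iff)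
  ultimately show ?thesis
    unfolding S_def[symmetric] by (rule holomorphic_transform)
qed

text \<open>One more summation by parts in the tail: its lower end becomes the new boundary term,
  and its upper end decays like n^(-Re s - r).\<close>

lemma continuation_Suc:
  assumes g: "zero_sum_periodic N g" and s: "Re s > 1 - real r"
  shows "continuation N g (Suc r) s = continuation N g r s"
proof -
  let ?G = "iter_antidiff N g" and ?u = "\<lambda>r. (fdiff ^^ r) (npow s)"
  obtain B where B: "B \<ge> 0" "\<And>n. norm (?G (Suc r) n) \<le> B"
    using zero_sum_periodic_bounded[OF zero_sum_periodic_iter[OF g]] by metis
  have lim: "(\<lambda>n. ?G (Suc r) n * ?u r (Suc n)) \<longlonglongrightarrow> 0"
  proof (rule Lim_null_comparison[OF always_eventually])
    have "(\<lambda>n. real n powr (- Re s - real r)) \<longlonglongrightarrow> 0"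
      using s by (intro tendsto_neg_powr filterlim_real_sequentially) auto
    then have "(\<lambda>n. real (Suc n) powr (- Re s - real r)) \<longlonglongrightarrow> 0"
      by (rule LIMSEQ_Suc)
    then have "(\<lambda>n. B * ((norm s + real r) ^ r * real (Suc n) powr (- Re s - real r))) \<longlonglongrightarrow>
        B * ((norm s + real r) ^ r * 0)"
      by (intro tendsto_intros)
    then show "(\<lambda>n. B * ((norm s + real r) ^ r * real (Suc n) powr (- Re s - real r))) \<longlonglongrightarrow> 0"
      by simp
    show "\<forall>n. norm (?G (Suc r) n * ?u r (Suc n)) \<le>
        B * ((norm s + real r) ^ r * real (Suc n) powr (- Re s - real r))"
      unfolding norm_mult using B s norm_fdiff_npow_le[of "Suc _" s r]
      by (intro allI mult_mono) auto
  qed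
  have eq: "(\<Sum>n<M. tail_term N g r s n) = ?G (Suc r) M * ?u r (Suc M) - ?G (Suc r) 0 * ?u r 1
      - (\<Sum>n<M. tail_term N g (Suc r) s n)" for M
  proof (induction M)
    case (Suc M)
    have "?G r (Suc M) = ?G (Suc r) (Suc M) - ?G (Suc r) M"
      using antidiff_diff[of "Suc M" N "?G r"] by simp
    then have "tail_term N g r s M = (?G (Suc r) (Suc M) - ?G (Suc r) M) * ?u r (Suc M)"
      by (simp add: tail_term_def del: funpow.simps)
    moreover have "tail_term N g (Suc r) s M =
        ?G (Suc r) (Suc M) * (?u r (Suc (Suc M)) - ?u r (Suc M))"
      unfolding tail_term_def fdiff_pow_Suc ..
    ultimately show ?case
      unfolding sum.lessThan_Suc Suc.IH by (simp add: algebra_simps del: funpow.simps)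
  qed simp
  have lim1: "(\<lambda>M. \<Sum>n<M. tail_term N g r s n) \<longlonglongrightarrow> 0 - ?G (Suc r) 0 * ?u r 1
      - (\<Sum>n. tail_term N g (Suc r) s n)"
    unfolding eq
    by (intro tendsto_diff lim tendsto_const summable_LIMSEQ summable_tail_term[OF g]) (use s in simp)
  have lim2: "(\<lambda>M. \<Sum>n<M. tail_term N g r s n) \<longlonglongrightarrow> (\<Sum>n. tail_term N g r s n)"
    by (intro summable_LIMSEQ summable_tail_term[OF g] s)
  have eq': "(\<Sum>n. tail_term N g r s n) = - (?G (Suc r) 0 * ?u r 1)
      - (\<Sum>n. tail_term N g (Suc r) s n)"
    using LIMSEQ_unique[OF lim2 lim1] by simp
  show ?thesis
    unfolding continuation_def eq' boundary_def by (simp add: algebra_simps del: funpow.simps)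
qed

lemma continuation_mono:
  assumes "zero_sum_periodic N g" "Re s > 1 - real r" "r \<le> r'"
  shows "continuation N g r' s = continuation N g r s"
  using assms(3)
proof (induction r' rule: dec_induct)
  case (step n)
  then show ?case using continuation_Suc[OF assms(1), of n s] assms(2) by simp
qed simp

lemma continuation_neg_int:
  assumes "k > 0"
  shows "continuation N g (Suc k) (1 - of_nat k) = regularized_value N g k"
proof -
  \<comment> \<open>At m = 0 and k = 1 the two sides differ, since 0 powr 0 is 0 while 0^0 is 1. The
    differences are taken at \<open>Suc n\<close> and never see the index 0.\<close>
  have "npow (1 - of_nat k) m = of_nat m ^ (k - 1)" if "m \<ge> 1" for m
  proof -
    have "- (1 - of_nat k) = (of_nat (k - 1) :: complex)"
      using assms by (simp add: of_nat_diff)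
    then show ?thesis using that by simp
  qed
  then have *: "(fdiff ^^ r) (npow (1 - of_nat k)) (Suc n) = (fdiff ^^ r) (\<lambda>m. of_nat m ^ (k - 1)) (Suc n)"
    for r n by (intro fdiff_pow_cong) auto
  have "tail_term N g (Suc k) (1 - of_nat k) = (\<lambda>_. 0)"
    unfolding tail_term_def * by (simp add: fdiff_pow_power_eq_0 del: funpow.simps)
  then show ?thesis
    unfolding continuation_def regularized_value_def boundary_def * by simp
qed

text \<open>The functions \<open>continuation N g r\<close> glue to an entire function, which shows
  that the choice in \<open>dirichlet_L\<close> has a witness. The chosen function agrees with it on
  Re s > 1, hence on the connected set \<open>- {1}\<close>.\<close>

theorem dirichlet_L_neg_int:
  fixes \<psi> :: "int \<Rightarrow> complex"
  assumes g: "zero_sum_periodic N (\<lambda>n. \<psi> (int n))" and "k > 0"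
  shows "dirichlet_L \<psi> (1 - of_nat k) = regularized_value N (\<lambda>n. \<psi> (int n)) k"
proof -
  let ?g = "\<lambda>n. \<psi> (int n)"
  let ?P = "\<lambda>f. f holomorphic_on - {1} \<and>
     (\<forall>s. Re s > 1 \<longrightarrow> (\<lambda>n. \<psi> (int (Suc n)) / of_nat (Suc n) powr s) sums f s)"
  \<comment> \<open>The order depends on s only to exceed 1 - Re s; by
    \<open>continuation_mono\<close> every admissible order gives the same value, so f is
    holomorphic on each half-plane.\<close>
  define f where "f = (\<lambda>s. continuation N ?g (Suc (nat \<lceil>1 - Re s\<rceil>)) s)"
  have f: "f s = continuation N ?g r s" if "Re s > 1 - real r" for r s
  proof -
    have "Re s > 1 - real (Suc (nat \<lceil>1 - Re s\<rceil>))" by linarith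
    with that show ?thesis
      unfolding f_def using continuation_mono[OF g]
      by (metis (no_types, lifting) nat_le_linear)
  qed
  have "UNIV = (\<Union>r. {s. Re s > 1 - real r})"
  proof -
    have "\<exists>r. Re s > 1 - real r" for s
      using reals_Archimedean2[of "1 - Re s"] by (auto simp: algebra_simps)
    then show ?thesis by auto
  qed
  moreover have "f holomorphic_on (\<Union>r. {s. Re s > 1 - real r})"
  proof (rule holomorphic_on_UN_open)
    show "f holomorphic_on {s. Re s > 1 - real r}" for r
      using continuation_holomorphic[OF g, of r] f by (subst holomorphic_cong[OF refl]) auto
  qed (rule open_halfspace_Re_gt)
  ultimately have hol: "f holomorphic_on UNIV" by simp
  have "(\<lambda>n. \<psi> (int (Suc n)) / of_nat (Suc n) powr s) sums f s" if "Re s > 1" for s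
  proof -
    have 1: "f s = (\<Sum>n. tail_term N ?g 0 s n)"
      using f[of 0 s] that by (simp add: continuation_def boundary_def)
    have 2: "summable (tail_term N ?g 0 s)"
      using that by (intro summable_tail_term g) auto
    have "tail_term N ?g 0 s = (\<lambda>n. \<psi> (int (Suc n)) / of_nat (Suc n) powr s)"
      by (rule ext) (simp add: tail_term_def powr_minus divide_inverse)
    then show ?thesis
      using summable_sums[OF 2] by (simp only: 1)
  qed
  then have "?P f" using hol holomorphic_on_subset by blast
  then have P: "?P (dirichlet_L \<psi>)"
    unfolding dirichlet_L_def by (rule someI[of ?P])
  have "dirichlet_L \<psi> (1 - of_nat k) = f (1 - of_nat k)"
  proof (rule analytic_continuation_open[where s = "{s. Re s > 1}" and s' = "- {1}"
      and f = "dirichlet_L \<psi>" and g = f])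
    show "{s. Re s > 1} \<noteq> {}" 
    proof -
      have "2 \<in> {s. Re s > 1}" by simp
      then show ?thesis by blast
    qed
    show "connected (- {1 :: complex})" by (rule connected_punctured_universe) simp
    show "dirichlet_L \<psi> z = f z" if "z \<in> {s. Re s > 1}" for z
      using P \<open>?P f\<close> that sums_unique2 by blast
    show "dirichlet_L \<psi> holomorphic_on - {1}" "f holomorphic_on - {1}"
      using P \<open>?P f\<close> by blast+
  qed (use \<open>k > 0\<close> in \<open>auto simp: open_halfspace_Re_gt\<close>)
  also have "\<dots> = continuation N ?g (Suc k) (1 - of_nat k)"
    by (rule f) simp
  also have "\<dots> = regularized_value N ?g k"
    by (rule continuation_neg_int[OF \<open>k > 0\<close>])
  finally show ?thesis .
qed


section \<open>Sums over arithmetic progressions\<close>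

lemma sum_lessThan_mult:
  fixes f :: "nat \<Rightarrow> 'b::comm_monoid_add"
  shows "(\<Sum>l<a * b. f l) = (\<Sum>i<a. \<Sum>j<b. f (i + a * j))"
proof -
  have "(\<Sum>l<a * b. f l) = (\<Sum>j<b. sum f {j * a..<j * a + a})"
    by (subst sum.nat_group) (simp add: mult.commute)
  also have "sum f {j * a..<j * a + a} = (\<Sum>i<a. f (i + a * j))" for j
    using sum.shift_bounds_nat_ivl[of f 0 "j * a" a]
    by (simp add: add.commute mult.commute atLeast0LessThan)
  then have "(\<Sum>j<b. sum f {j * a..<j * a + a}) = (\<Sum>j<b. \<Sum>i<a. f (i + a * j))"
    by simp
  also have "\<dots> = (\<Sum>i<a. \<Sum>j<b. f (i + a * j))"
    by (rule sum.swap)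
  finally show ?thesis .
qed

text \<open>As q is a unit modulo D, the map l to b + q l permutes the residue classes.\<close>

lemma sum_progression:
  fixes h :: "nat \<Rightarrow> 'b::comm_monoid_add"
  assumes "\<And>n. h n = h (n mod D)" "D > 0" "coprime q D"
  shows "(\<Sum>l<D. h (b + q * l)) = (\<Sum>l<D. h l)"
proof -
  have inj: "inj_on (\<lambda>l. (b + q * l) mod D) {..<D}"
  proof (rule inj_onI)
    fix x y assume xy: "x \<in> {..<D}" "y \<in> {..<D}" "(b + q * x) mod D = (b + q * y) mod D"
    then have "[b + q * x = b + q * y] (mod D)" by (simp add: Cong.cong_def)
    then have "[q * x = q * y] (mod D)" by (simp add: cong_add_lcancel_nat)
    then have "[x = y] (mod D)"
      using assms(3) by (simp add: cong_mult_lcancel_nat)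
    with xy show "x = y" by (simp add: Cong.cong_def)
  qed
  have "(\<lambda>l. (b + q * l) mod D) ` {..<D} = {..<D}"
    by (rule card_subset_eq) (use assms(2) in \<open>auto simp: card_image[OF inj]\<close>)
  then have "(\<Sum>l<D. h l) = (\<Sum>l<D. h ((b + q * l) mod D))"
    using sum.reindex[OF inj, of h] by simp
  also have "\<dots> = (\<Sum>l<D. h (b + q * l))"
    using assms(1) by (intro sum.cong) metis+
  finally show ?thesis ..
qed

lemma zero_sum_periodic_progression:
  assumes "zero_sum_periodic D h" "coprime q D"
  shows "zero_sum_periodic D (\<lambda>l. h (b + q * l))"
  unfolding zero_sum_periodic_def
proof (intro conjI allI)
  have D: "D > 0" using assms(1) by (simp add: zero_sum_periodic_def)
  then show "D > 0" .
  have mod: "h n = h (n mod D)" for n by (rule zero_sum_periodic_mod[OF assms(1)])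
  show "h (b + q * (n + D)) = h (b + q * n)" for n
  proof -
    have "(b + q * (n + D)) mod D = (b + q * n) mod D"
      by (metis add.assoc add_mult_distrib2 mod_mult_self1)
    then show ?thesis by (metis mod)
  qed
  show "(\<Sum>n<D. h (b + q * n)) = 0"
    using sum_progression[of h D q b, OF mod D assms(2)] assms(1) by (simp add: zero_sum_periodic_def)
qed

text \<open>Both sides count \<open>\<Sum>l<p * D. y l * l\<close>, grouped by residues modulo \<open>p\<close> and modulo \<open>D\<close>.\<close>

lemma zero_sum_first_moment:
  fixes y :: "nat \<Rightarrow> 'a::field_char_0"
  assumes y: "zero_sum_periodic D y" and "coprime p D" "p > 0"
  shows "(\<Sum>i<p. \<Sum>j<D. y (i + p * j) * of_nat j) = (\<Sum>l<D. y l * of_nat l)"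
proof -
  have zero: "(\<Sum>j<D. y (i + p * j)) = 0" for i
    using zero_sum_periodic_progression[OF assms(1,2), of i] by (simp add: zero_sum_periodic_def)
  have zero': "(\<Sum>l<D. y l) = 0" and per: "y (l + D * i) = y l" for l i
    using y zero_sum_periodic_mod[OF y, of "l + D * i"] zero_sum_periodic_mod[OF y, of l]
    by (auto simp: zero_sum_periodic_def)
  have "(\<Sum>l<p * D. y l * of_nat l) =
      (\<Sum>i<p. of_nat i * (\<Sum>j<D. y (i + p * j)) + of_nat p * (\<Sum>j<D. y (i + p * j) * of_nat j))"
    unfolding sum_lessThan_mult by (simp add: sum_distrib_left sum.distrib distrib_left mult_ac)
  also have "\<dots> = of_nat p * (\<Sum>i<p. \<Sum>j<D. y (i + p * j) * of_nat j)"
    by (simp add: zero sum_distrib_left)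
  finally have 1: "(\<Sum>l<p * D. y l * of_nat l) = of_nat p * (\<Sum>i<p. \<Sum>j<D. y (i + p * j) * of_nat j)" .
  have "(\<Sum>l<p * D. y l * of_nat l) = (\<Sum>l<D * p. y l * of_nat l)"
    by (simp only: mult.commute[of p D])
  also have "\<dots> = (\<Sum>l<D. \<Sum>i<p. y l * (of_nat l + of_nat D * of_nat i))"
    unfolding sum_lessThan_mult by (simp add: per)
  also have "\<dots> = (\<Sum>l<D. of_nat p * (y l * of_nat l) + of_nat D * (\<Sum>i<p. of_nat i) * y l)"
    by (simp add: sum.distrib distrib_left sum_distrib_left sum_distrib_right mult_ac)
  also have "\<dots> = of_nat p * (\<Sum>l<D. y l * of_nat l)"
    by (simp add: sum.distrib sum_distrib_left[symmetric] zero')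
  finally have "of_nat p * (\<Sum>i<p. \<Sum>j<D. y (i + p * j) * of_nat j) = of_nat p * (\<Sum>l<D. y l * of_nat l)"
    by (simp only: 1)
  then show ?thesis using \<open>p > 0\<close> by simp
qed

text \<open>The cofactor w is a natural number; this makes the remainder p-adically as small as
  x^2.\<close>

lemma power_add_expansion:
  "\<exists>w :: nat. (a + x) ^ k = a ^ k + k * a ^ (k - 1) * x + x ^ 2 * w"
proof (induction k)
  case (Suc k)
  then obtain w where "(a + x) ^ k = a ^ k + k * a ^ (k - 1) * x + x ^ 2 * w" ..
  then have "(a + x) ^ Suc k = (a + x) * (a ^ k + k * a ^ (k - 1) * x + x ^ 2 * w)" by simp
  also have "\<dots> = a ^ Suc k + Suc k * a ^ k * x + x ^ 2 * (a * w + x * w + k * a ^ (k - 1))"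
    by (cases k) (simp_all add: algebra_simps power2_eq_square)
  finally show ?case by auto
qed auto


section \<open>Convergence in the p-adic complex numbers\<close>

context padic_complex_field
begin

text \<open>The type class of \<open>'c\<close> provides a field and a metric separately; continuity
  of the field operations comes from the ultrametric inequality and the multiplicativity of
  \<open>pabs\<close>.\<close>

lemma padic_tendsto_add:
  assumes "(f \<longlongrightarrow> (a :: 'c)) F" "(g \<longlongrightarrow> b) F"
  shows "((\<lambda>x. f x + g x) \<longlongrightarrow> a + b) F"
  unfolding tendsto_iff_pabs[of _ "a + b"]
proof (rule Lim_null_comparison[OF always_eventually])
  have "((\<lambda>x. pabs (f x - a) + pabs (g x - b)) \<longlongrightarrow> 0 + 0) F"
    using assms by (intro tendsto_add) (simp_all add: tendsto_iff_pabs[symmetric])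
  then show "((\<lambda>x. pabs (f x - a) + pabs (g x - b)) \<longlongrightarrow> 0) F" by simp
  show "\<forall>x. norm (pabs (f x + g x - (a + b))) \<le> pabs (f x - a) + pabs (g x - b)"
  proof
    fix x
    have "pabs (f x + g x - (a + b)) \<le> max (pabs (f x - a)) (pabs (g x - b))"
      using pabs_add[of "f x - a" "g x - b"] by (simp add: algebra_simps)
    then show "norm (pabs (f x + g x - (a + b))) \<le> pabs (f x - a) + pabs (g x - b)"
      using pabs_nonneg[of "f x - a"] pabs_nonneg[of "g x - b"] pabs_nonneg[of "f x + g x - (a + b)"]
      by simp
  qed
qed

lemma padic_tendsto_mult:
  assumes "(f \<longlongrightarrow> (a :: 'c)) F" "(g \<longlongrightarrow> b) F"
  shows "((\<lambda>x. f x * g x) \<longlongrightarrow> a * b) F"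
  unfolding tendsto_iff_pabs[of _ "a * b"]
proof (rule Lim_null_comparison[OF always_eventually])
  let ?h = "\<lambda>x. pabs (f x - a) * pabs (g x - b) + (pabs a * pabs (g x - b) + pabs (f x - a) * pabs b)"
  have "(?h \<longlongrightarrow> 0 * 0 + (pabs a * 0 + 0 * pabs b)) F"
    using assms by (intro tendsto_add tendsto_mult tendsto_const) (simp_all add: tendsto_iff_pabs[symmetric])
  then show "(?h \<longlongrightarrow> 0) F" by simp
  show "\<forall>x. norm (pabs (f x * g x - a * b)) \<le> ?h x"
  proof
    fix x
    have "f x * g x - a * b = (f x - a) * (g x - b) + (a * (g x - b) + (f x - a) * b)"
      by (simp add: algebra_simps)
    then have "pabs (f x * g x - a * b) \<le> max (pabs ((f x - a) * (g x - b)))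
        (max (pabs (a * (g x - b))) (pabs ((f x - a) * b)))"
      using pabs_add[of "(f x - a) * (g x - b)" "a * (g x - b) + (f x - a) * b"]
        pabs_add[of "a * (g x - b)" "(f x - a) * b"] by simp
    also have "\<dots> \<le> ?h x"
      by (simp add: pabs_mult pabs_nonneg add_increasing add_increasing2)
    finally show "norm (pabs (f x * g x - a * b)) \<le> ?h x"
      by (simp add: pabs_nonneg)
  qed
qed

lemma padic_tendsto_diff:
  assumes "(f \<longlongrightarrow> (a :: 'c)) F" "(g \<longlongrightarrow> b) F"
  shows "((\<lambda>x. f x - g x) \<longlongrightarrow> a - b) F"
  using padic_tendsto_add[OF assms(1) padic_tendsto_mult[OF tendsto_const[of "- 1"] assms(2)]] by simp

lemma padic_tendsto_sum:
  assumes "\<And>i. i \<in> I \<Longrightarrow> (f i \<longlongrightarrow> (a i :: 'c)) F"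
  shows "((\<lambda>x. \<Sum>i\<in>I. f i x) \<longlongrightarrow> (\<Sum>i\<in>I. a i)) F"
  using assms
proof (induction I rule: infinite_finite_induct)
  case (insert i I)
  then show ?case by (simp add: padic_tendsto_add)
qed simp_all

lemma padic_tendsto_poly:
  assumes "(f \<longlongrightarrow> (a :: 'c)) F"
  shows "((\<lambda>x. poly q (f x)) \<longlongrightarrow> poly q a) F"
  by (induction q) (simp_all add: padic_tendsto_add padic_tendsto_mult[OF assms])

lemma continuous_on_poly_padic: "continuous_on A (poly (q :: 'c poly))"
  unfolding continuous_on_def by (intro ballI padic_tendsto_poly tendsto_ident_at)

lemma padic_tendsto_0:
  assumes "\<And>n. n \<ge> N \<Longrightarrow> pabs (f n :: 'c) \<le> 1 / real p ^ n"
  shows "f \<longlonglongrightarrow> 0"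
proof -
  have "(\<lambda>n. pabs (f n - 0)) \<longlonglongrightarrow> 0"
  proof (rule Lim_null_comparison[OF _ inv_p_power_tendsto_0])
    show "\<forall>\<^sub>F n in sequentially. norm (pabs (f n - 0)) \<le> 1 / real p ^ n"
      using assms by (auto simp: eventually_sequentially pabs_nonneg)
  qed
  then show ?thesis by (simp only: tendsto_iff_pabs[of f 0])
qed

lemma p_power_tendsto_0: "(\<lambda>n. of_nat (p ^ n) :: 'c) \<longlonglongrightarrow> 0"
  by (rule padic_tendsto_0[of 0]) (simp only: pabs_p_power)

section \<open>Arithmetic of \<open>Zp\<close> and its units\<close>

lemma Zp_iff_limit: "(x :: 'c) \<in> Zp \<longleftrightarrow> (\<exists>f. (\<forall>n. f n \<in> \<int>) \<and> f \<longlonglongrightarrow> x)"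
  by (simp add: Zp_def closure_sequential)

lemma Zp_closed: "closed (Zp :: 'c set)"
  by (simp add: Zp_def)

lemma Ints_in_Zp: "x \<in> \<int> \<Longrightarrow> (x :: 'c) \<in> Zp"
  unfolding Zp_def using closure_subset by blast

lemma Zp_add: "(x :: 'c) \<in> Zp \<Longrightarrow> y \<in> Zp \<Longrightarrow> x + y \<in> Zp"
proof -
  assume "x \<in> Zp" "y \<in> Zp"
  then obtain f g where f: "\<And>n. f n \<in> \<int>" "f \<longlonglongrightarrow> x" and g: "\<And>n. g n \<in> \<int>" "g \<longlonglongrightarrow> y"
    by (auto simp: Zp_iff_limit)
  have "(\<lambda>n. f n + g n) \<longlonglongrightarrow> x + y" by (rule padic_tendsto_add[OF f(2) g(2)])
  with f(1) g(1) show "x + y \<in> Zp" unfolding Zp_iff_limit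
    by (intro exI[of _ "\<lambda>n. f n + g n"]) auto
qed

lemma Zp_mult: "(x :: 'c) \<in> Zp \<Longrightarrow> y \<in> Zp \<Longrightarrow> x * y \<in> Zp"
proof -
  assume "x \<in> Zp" "y \<in> Zp"
  then obtain f g where f: "\<And>n. f n \<in> \<int>" "f \<longlonglongrightarrow> x" and g: "\<And>n. g n \<in> \<int>" "g \<longlonglongrightarrow> y"
    by (auto simp: Zp_iff_limit)
  have "(\<lambda>n. f n * g n) \<longlonglongrightarrow> x * y" by (rule padic_tendsto_mult[OF f(2) g(2)])
  with f(1) g(1) show "x * y \<in> Zp" unfolding Zp_iff_limit
    by (intro exI[of _ "\<lambda>n. f n * g n"]) auto
qed

lemma Zp_sum: "(\<And>i. i \<in> I \<Longrightarrow> (f i :: 'c) \<in> Zp) \<Longrightarrow> sum f I \<in> Zp"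
  by (induction I rule: infinite_finite_induct) (auto intro: Zp_add Ints_in_Zp)

lemma Zp_units_inverse:
  assumes "(x :: 'c) \<in> Zp_units"
  shows "inverse x \<in> Zp" "pabs (inverse x) = 1" "x \<noteq> 0" "pabs x = 1"
proof -
  have x: "x \<in> Zp" "pabs x = 1" using assms by (auto simp: Zp_units_eq)
  then show "inverse x \<in> Zp" by (rule Zp_inverse)
  show "x \<noteq> 0" using x(2) pabs_eq_0_iff[of x] by auto
  then show "pabs (inverse x) = 1"
    using pabs_mult[of x "inverse x"] x(2) by (simp add: pabs_1)
  show "pabs x = 1" by (rule x)
qed

lemma pabs_of_nat_coprime: "coprime n p \<Longrightarrow> pabs (of_nat n :: 'c) = 1"
  using pabs_of_int_coprime[of "int n"] by simp

lemma pabs_diff_le_iff_cong: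
  "pabs (of_nat a - of_nat b :: 'c) \<le> 1 / real p ^ n \<longleftrightarrow> [a = b] (mod p ^ n)"
  using pabs_of_int_le_iff[of "int a - int b" n]
  by (simp add: cong_int_iff[symmetric] cong_iff_dvd_diff)

lemma totatives_coprime: "a \<in> totatives (p ^ n) \<Longrightarrow> n > 0 \<Longrightarrow> coprime a p"
  by (auto simp: in_totatives_iff)

lemma totatives_p_power:
  assumes "n > 0"
  shows "totatives (p ^ n) = {a. a < p ^ n \<and> coprime a p}"
proof (intro equalityI subsetI)
  fix a assume "a \<in> totatives (p ^ n)"
  then show "a \<in> {a. a < p ^ n \<and> coprime a p}"
    using totatives_less[of a "p ^ n"] one_less_power[OF p_gt_1, of n] totatives_coprime assms by auto
next
  fix a assume "a \<in> {a. a < p ^ n \<and> coprime a p}"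
  then show "a \<in> totatives (p ^ n)"
    using p_gt_1 assms by (cases "a = 0") (auto simp: in_totatives_iff)
qed


section \<open>The measure attached to a periodic sequence\<close>

text \<open>
  The regularized value at 0 of the series \<open>\<Sum> h n / n ^ s\<close> over \<open>n\<close> in the residue class of \<open>a\<close> modulo
  \<open>p ^ m\<close>.
\<close>

definition class_value :: "nat \<Rightarrow> (nat \<Rightarrow> 'c) \<Rightarrow> nat \<Rightarrow> nat \<Rightarrow> 'c" where
  "class_value D h m a = - (\<Sum>j<D. h (a + p ^ m * j) * of_nat j) / of_nat D"

text \<open>
  At level 0 the formula would include the residue class of 0 modulo \<open>p\<close>, which has to be left out.
\<close>

definition value_measure :: "nat \<Rightarrow> (nat \<Rightarrow> 'c) \<Rightarrow> nat \<Rightarrow> nat \<Rightarrow> 'c" where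
  "value_measure D h m a =
     (if a \<notin> totatives (p ^ m) then 0
      else if m = 0 then \<Sum>b\<in>totatives p. class_value D h 1 b
      else class_value D h m a)"

lemma pabs_0: "pabs (0 :: 'c) = 0"
  by (simp add: pabs_def)

lemma coprime_p_power: "coprime D p \<Longrightarrow> coprime (p ^ m) D"
  by (simp add: coprime_commute)

lemma sum_residues_above:
  assumes "n > 0" "b \<in> totatives (p ^ n)"
  shows "(\<Sum>a | a \<in> totatives (p ^ Suc n) \<and> [a = b] (mod p ^ n). f a) = (\<Sum>i<p. f (b + p ^ n * i) :: 'c)"
proof -
  have b: "b < p ^ n" "coprime b p" using assms by (auto simp: totatives_p_power)
  have cop: "coprime (b + p ^ n * i) p" for i
  proof -
    have "p ^ n * i = p * (p ^ (n - 1) * i)"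
      using assms(1) by (cases n) auto
    then show ?thesis using b(2) by (metis coprime_iff_gcd_eq_1 gcd_add_mult mult.commute gcd.commute add.commute)
  qed
  have "{a. a \<in> totatives (p ^ Suc n) \<and> [a = b] (mod p ^ n)} = (\<lambda>i. b + p ^ n * i) ` {..<p}"
  proof (intro equalityI subsetI)
    fix a assume "a \<in> {a. a \<in> totatives (p ^ Suc n) \<and> [a = b] (mod p ^ n)}"
    then have a: "a < p * p ^ n" "a mod p ^ n = b"
      using b(1) totatives_p_power[of "Suc n"] by (auto simp: Cong.cong_def)
    then have "a = b + p ^ n * (a div p ^ n)"
      by (metis add.commute mult_div_mod_eq)
    moreover have "a div p ^ n < p"
      using a(1) by (simp add: less_mult_imp_div_less)
    ultimately show "a \<in> (\<lambda>i. b + p ^ n * i) ` {..<p}" by blast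
  next
    fix a assume "a \<in> (\<lambda>i. b + p ^ n * i) ` {..<p}"
    then obtain i where i: "i < p" "a = b + p ^ n * i" by auto
    have "b + p ^ n * i < p ^ n * Suc i" using b(1) by simp
    also have "\<dots> \<le> p ^ n * p" using i(1) by (intro mult_le_mono) auto
    finally have "a < p ^ Suc n" by (simp add: i(2) mult.commute)
    then show "a \<in> {a. a \<in> totatives (p ^ Suc n) \<and> [a = b] (mod p ^ n)}"
      using cop[of i] totatives_p_power[of "Suc n"] i(2) by (simp add: Cong.cong_def del: power_Suc)
  qed
  moreover have "inj_on (\<lambda>i. b + p ^ n * i) {..<p}"
    using p_gt_1 by (intro inj_onI) simp
  ultimately show ?thesis by (simp add: sum.reindex)
qed

text \<open>Indexing the class of b modulo p^n by l, passing to the next level splits l by its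
  residue modulo p; \<open>zero_sum_first_moment\<close> says that the first moment does not
  change.\<close>

lemma class_value_distribution:
  assumes h: "zero_sum_periodic D h" and "coprime D p"
  shows "(\<Sum>i<p. class_value D h (Suc n) (b + p ^ n * i)) = class_value D h n b"
proof -
  define y where "y = (\<lambda>l. h (b + p ^ n * l))"
  have y: "zero_sum_periodic D y"
    unfolding y_def by (intro zero_sum_periodic_progression h coprime_p_power assms)
  have "h (b + p ^ n * i + p ^ Suc n * j) = y (i + p * j)" for i j
    by (simp add: y_def algebra_simps)
  then have "(\<Sum>i<p. class_value D h (Suc n) (b + p ^ n * i)) =
      - (\<Sum>i<p. \<Sum>j<D. y (i + p * j) * of_nat j) / of_nat D"
    by (simp add: class_value_def sum_negf sum_divide_distrib del: power_Suc)
  also have "\<dots> = class_value D h n b"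
    using zero_sum_first_moment[OF y, of p] assms(2) p_gt_1
    by (simp add: class_value_def y_def coprime_commute)
  finally show ?thesis .
qed

text \<open>The only denominator is D, a p-adic unit.\<close>

lemma pabs_class_value_le:
  assumes "coprime D p" "\<And>n. pabs (h n) \<le> 1"
  shows "pabs (class_value D h m a) \<le> 1"
proof -
  have "pabs (\<Sum>j<D. h (a + p ^ m * j) * of_nat j) \<le> 1"
    using assms(2) pabs_of_nat
    by (intro pabs_sum_le) (auto simp: pabs_mult intro!: mult_le_one pabs_nonneg)
  moreover have "pabs (inverse (of_nat D :: 'c)) = 1"
  proof -
    have "pabs (of_nat D :: 'c) = 1" by (rule pabs_of_nat_coprime[OF assms(1)])
    moreover from this have "(of_nat D :: 'c) \<noteq> 0" using pabs_eq_0_iff[of "of_nat D"] by auto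
    ultimately show ?thesis
      using pabs_mult[of "of_nat D" "inverse (of_nat D)"] by (simp add: pabs_1)
  qed
  ultimately show ?thesis
    by (simp add: class_value_def divide_inverse pabs_mult pabs_minus)
qed

text \<open>Only boundedness and additivity are at stake here, hence \<open>UNIV\<close>; that the
  coefficients lie in L is settled for the twisted measure.\<close>

lemma value_measure_in_iwasawa:
  assumes h: "zero_sum_periodic D h" and D: "coprime D p" and le: "\<And>n. pabs (h n) \<le> 1"
  shows "value_measure D h \<in> iwasawa_algebra p (UNIV :: 'c set)"
  unfolding iwasawa_algebra_def mem_Collect_eq
proof (intro conjI allI impI ballI)
  fix n a assume "a \<in> totatives (p ^ n)"
  then show "value_measure D h n a \<in> ring_of_integers UNIV"
    using pabs_class_value_le[of D h, OF D le]
    by (auto simp: value_measure_def ring_of_integers_def intro!: pabs_sum_le)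
next
  fix n a assume "a \<notin> totatives (p ^ n)"
  then show "value_measure D h n a = 0" by (simp add: value_measure_def)
next
  fix n b assume b: "b \<in> totatives (p ^ n)"
  have "(\<Sum>a | a \<in> totatives (p ^ Suc n) \<and> [a = b] (mod p ^ n). value_measure D h (Suc n) a) =
      (\<Sum>a | a \<in> totatives (p ^ Suc n) \<and> [a = b] (mod p ^ n). class_value D h (Suc n) a)"
    by (intro sum.cong) (auto simp: value_measure_def simp del: power_Suc)
  also have "\<dots> = value_measure D h n b"
  proof (cases "n = 0")
    case True
    then show ?thesis using b by (simp add: value_measure_def Cong.cong_def)
  next
    case False
    then show ?thesis
      using b class_value_distribution[OF h D, of n b]
      by (simp add: sum_residues_above value_measure_def del: power_Suc)
  qed
  finally show "(\<Sum>a | a \<in> totatives (p ^ Suc n) \<and> [a = b] (mod p ^ n). value_measure D h (Suc n) a) =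
      value_measure D h n b" .
qed


section \<open>Twisting a measure by the inverse function\<close>

definition coset_indicator :: "nat \<Rightarrow> nat \<Rightarrow> 'c \<Rightarrow> 'c" where
  "coset_indicator m a x = (if pabs (x - of_nat a) \<le> 1 / real p ^ m then 1 else 0)"

definition inverse_twist :: "(nat \<Rightarrow> nat \<Rightarrow> 'c) \<Rightarrow> nat \<Rightarrow> nat \<Rightarrow> 'c" where
  "inverse_twist \<mu> m a =
     (if a \<in> totatives (p ^ m) then measure_integral p \<mu> (\<lambda>x. inverse x * coset_indicator m a x) else 0)"

lemma coset_indicator_of_nat:
  "coset_indicator m a (of_nat b) = (if [b = a] (mod p ^ m) then 1 else 0)"
  by (simp add: coset_indicator_def pabs_diff_le_iff_cong)

lemma pabs_coset_indicator_le: "pabs (coset_indicator m a x) \<le> 1"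
  by (simp add: coset_indicator_def pabs_1 pabs_0)

text \<open>In an ultrametric, two points at distance at most the radius lie in the same balls of
  that radius.\<close>

lemma coset_indicator_cong:
  assumes "pabs (x - y) \<le> 1 / real p ^ m"
  shows "coset_indicator m a x = coset_indicator m a y"
proof -
  have "pabs (y - of_nat a) \<le> max (pabs (x - of_nat a)) (pabs (x - y))"
    using pabs_diff[of "x - of_nat a" "x - y"] by simp
  moreover have "pabs (x - of_nat a) \<le> max (pabs (y - of_nat a)) (pabs (x - y))"
    using pabs_add[of "y - of_nat a" "x - y"] by simp
  ultimately show ?thesis
    using assms unfolding coset_indicator_def by (auto simp: max_def split: if_splits)
qed

lemma continuous_on_Zp_units_I:
  fixes \<phi> :: "'c \<Rightarrow> 'c"
  assumes "\<And>x y. x \<in> Zp_units \<Longrightarrow> y \<in> Zp_units \<Longrightarrow> pabs (x - y) \<le> 1 / real p ^ m \<Longrightarrow>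
    pabs (\<phi> x - \<phi> y) \<le> pabs (x - y)"
  shows "continuous_on Zp_units \<phi>"
  unfolding continuous_on_iff
proof (intro ballI allI impI)
  fix x :: 'c and e :: real assume x: "x \<in> Zp_units" and "e > 0"
  show "\<exists>d>0. \<forall>x'\<in>Zp_units. dist x' x < d \<longrightarrow> dist (\<phi> x') (\<phi> x) < e"
  proof (intro exI[of _ "min e (1 / real p ^ m)"] conjI ballI impI)
    show "min e (1 / real p ^ m) > 0" using \<open>e > 0\<close> p_gt_1 by simp
    fix x' :: 'c assume x': "x' \<in> Zp_units" and d: "dist x' x < min e (1 / real p ^ m)"
    have "pabs (\<phi> x' - \<phi> x) \<le> pabs (x' - x)"
      using d by (intro assms x x') (simp add: dist_pabs)
    also have "\<dots> < e" using d by (simp add: dist_pabs)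
    finally show "dist (\<phi> x') (\<phi> x) < e" by (simp add: dist_pabs)
  qed
qed

lemma continuous_on_coset_indicator: "continuous_on Zp_units (coset_indicator m a)"
  by (rule continuous_on_Zp_units_I[of m])
     (use coset_indicator_cong pabs_nonneg in \<open>simp add: pabs_0\<close>)

lemma continuous_on_inverse_coset:
  "continuous_on Zp_units (\<lambda>x. inverse x * coset_indicator m a x)"
proof (rule continuous_on_Zp_units_I[of m])
  fix x y :: 'c assume xy: "x \<in> Zp_units" "y \<in> Zp_units" and "pabs (x - y) \<le> 1 / real p ^ m"
  then have eq: "coset_indicator m a x = coset_indicator m a y" by (intro coset_indicator_cong)
  have "inverse x * coset_indicator m a x - inverse y * coset_indicator m a y =
      (y - x) * (inverse x * inverse y) * coset_indicator m a y"
    unfolding eq using Zp_units_inverse(3)[OF xy(1)] Zp_units_inverse(3)[OF xy(2)]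
    by (simp add: field_simps)
  also have "pabs \<dots> = pabs (x - y) * pabs (coset_indicator m a y)"
    using Zp_units_inverse(2)[OF xy(1)] Zp_units_inverse(2)[OF xy(2)] pabs_minus[of "x - y"]
    by (simp add: pabs_mult)
  also have "\<dots> \<le> pabs (x - y) * 1"
    by (intro mult_left_mono pabs_nonneg) (rule pabs_coset_indicator_le)
  finally show "pabs (inverse x * coset_indicator m a x - inverse y * coset_indicator m a y) \<le> pabs (x - y)"
    by simp
qed

context
  fixes \<mu> and L :: "'c set"
  assumes \<mu>: "\<mu> \<in> iwasawa_algebra p L"
begin

lemma pabs_inverse_twist_le: "pabs (inverse_twist \<mu> m a) \<le> 1"
proof -
  have "pabs (inverse x * coset_indicator m a x) \<le> 1" if "x \<in> Zp_units" for x
    using Zp_units_inverse(2)[OF that] by (simp add: pabs_mult pabs_coset_indicator_le)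
  then show ?thesis
    using pabs_measure_integral_le[OF \<mu> continuous_on_inverse_coset, of m a 1]
    by (simp add: inverse_twist_def pabs_0)
qed

text \<open>For M > n every unit modulo p^M lies over exactly one class modulo p^(n+1), so
  additivity already holds for the Riemann sums at level M and passes to the limit.\<close>

lemma inverse_twist_compatible:
  assumes b: "b \<in> totatives (p ^ n)"
  shows "(\<Sum>a | a \<in> totatives (p ^ Suc n) \<and> [a = b] (mod p ^ n). inverse_twist \<mu> (Suc n) a) =
    inverse_twist \<mu> n b"
proof -
  let ?A = "{a. a \<in> totatives (p ^ Suc n) \<and> [a = b] (mod p ^ n)}"
  let ?r = "\<lambda>m a. riemann_sum p \<mu> (\<lambda>x. inverse x * coset_indicator m a x)"
  have fin: "finite ?A" by (rule finite_subset[of _ "totatives (p ^ Suc n)"]) auto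
  have eq: "(\<Sum>a\<in>?A. ?r (Suc n) a M) = ?r n b M" if "M \<ge> Suc n" for M
  proof -
    have ind: "(\<Sum>a\<in>?A. coset_indicator (Suc n) a (of_nat c)) = coset_indicator n b (of_nat c)"
      if c: "c \<in> totatives (p ^ M)" for c
    proof -
      define c' where "c' = totative_mod (Suc n) c"
      have c': "c' \<in> totatives (p ^ Suc n)"
        unfolding c'_def using c \<open>M \<ge> Suc n\<close> by (rule totative_mod_in)
      have *: "[c = a] (mod p ^ Suc n) \<longleftrightarrow> a = c'" if "a \<in> ?A" for a
        using totative_mod_eq_iff[of a "Suc n" c] that unfolding c'_def by auto
      have "[c = c'] (mod p ^ Suc n)"
        using totative_mod_eq_iff[OF c', of c] by (simp add: c'_def)
      then have "[c = c'] (mod p ^ n)"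
        by (rule cong_dvd_modulus_nat) simp
      then have "c' \<in> ?A \<longleftrightarrow> [c = b] (mod p ^ n)"
        using c' by (auto simp del: power_Suc intro: cong_trans cong_sym)
      moreover have "(\<Sum>a\<in>?A. coset_indicator (Suc n) a (of_nat c)) = (\<Sum>a\<in>?A. if a = c' then 1 else 0)"
        by (intro sum.cong refl) (simp add: coset_indicator_of_nat * del: power_Suc)
      ultimately show ?thesis
        using fin by (simp add: coset_indicator_of_nat del: power_Suc)
    qed
    have "(\<Sum>a\<in>?A. ?r (Suc n) a M) =
        (\<Sum>c\<in>totatives (p ^ M). \<Sum>a\<in>?A. inverse (of_nat c) * coset_indicator (Suc n) a (of_nat c) * \<mu> M c)"
      unfolding riemann_sum_def by (rule sum.swap)
    also have "\<dots> = ?r n b M"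
      unfolding riemann_sum_def
      by (intro sum.cong refl) (simp add: sum_distrib_left[symmetric] sum_distrib_right[symmetric] ind del: power_Suc)
    finally show ?thesis .
  qed
  have "(\<lambda>M. \<Sum>a\<in>?A. ?r (Suc n) a M) \<longlonglongrightarrow> (\<Sum>a\<in>?A. inverse_twist \<mu> (Suc n) a)"
  proof (rule padic_tendsto_sum)
    fix a assume "a \<in> ?A"
    then show "?r (Suc n) a \<longlonglongrightarrow> inverse_twist \<mu> (Suc n) a"
      using riemann_sum_tendsto[OF \<mu> continuous_on_inverse_coset, of "Suc n" a]
      by (simp add: inverse_twist_def del: power_Suc)
  qed
  then have "?r n b \<longlonglongrightarrow> (\<Sum>a\<in>?A. inverse_twist \<mu> (Suc n) a)"
    by (rule Lim_transform_eventually) (use eq in \<open>auto simp: eventually_sequentially\<close>)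
  moreover have "?r n b \<longlonglongrightarrow> inverse_twist \<mu> n b"
    using riemann_sum_tendsto[OF \<mu> continuous_on_inverse_coset, of n b] b by (simp add: inverse_twist_def)
  ultimately show ?thesis by (rule LIMSEQ_unique)
qed

lemma inverse_twist_in_iwasawa:
  assumes "\<And>n a. a \<in> totatives (p ^ n) \<Longrightarrow> inverse_twist \<mu> n a \<in> L'"
  shows "inverse_twist \<mu> \<in> iwasawa_algebra p L'"
  unfolding iwasawa_algebra_def mem_Collect_eq
proof (intro conjI allI impI ballI)
  show "inverse_twist \<mu> n a \<in> ring_of_integers L'" if "a \<in> totatives (p ^ n)" for n a
    using assms[OF that] pabs_inverse_twist_le by (simp add: ring_of_integers_def)
  show "inverse_twist \<mu> n a = 0" if "a \<notin> totatives (p ^ n)" for n a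
    using that by (simp add: inverse_twist_def)
qed (rule inverse_twist_compatible)

text \<open>On the coset of a, x and a are units with difference at most p^-m, so 1/x and 1/a are
  equally close; integrating preserves the bound.\<close>

lemma inverse_twist_approx:
  assumes a: "a \<in> totatives (p ^ m)" "m > 0"
  shows "pabs (inverse_twist \<mu> m a - inverse (of_nat a) * \<mu> m a) \<le> 1 / real p ^ m"
proof -
  let ?i = "coset_indicator m a"
  have u: "(of_nat a :: 'c) \<in> Zp_units" by (rule of_nat_in_Zp_units[OF a])
  have c: "continuous_on Zp_units (\<lambda>x. - inverse (of_nat a) * ?i x)"
  proof (rule continuous_on_Zp_units_I[of m])
    fix x y :: 'c assume "pabs (x - y) \<le> 1 / real p ^ m"
    then have "?i x = ?i y" by (rule coset_indicator_cong)
    then show "pabs (- inverse (of_nat a) * ?i x - - inverse (of_nat a) * ?i y) \<le> pabs (x - y)"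
      by (simp add: pabs_0 pabs_nonneg)
  qed
  have int_i: "measure_integral p \<mu> ?i = \<mu> m a"
    using measure_integral_coset[OF \<mu> a(1)] by (simp add: coset_indicator_def[abs_def])
  have "measure_integral p \<mu> (\<lambda>x. inverse x * ?i x + - inverse (of_nat a) * ?i x) =
      inverse_twist \<mu> m a + measure_integral p \<mu> (\<lambda>x. - inverse (of_nat a) * ?i x)"
    using a measure_integral_add[OF \<mu> continuous_on_inverse_coset c] by (simp add: inverse_twist_def)
  also have "measure_integral p \<mu> (\<lambda>x. - inverse (of_nat a) * ?i x) = - inverse (of_nat a) * \<mu> m a"
    using measure_integral_cmult[OF \<mu> continuous_on_coset_indicator] int_i by metis
  finally have eq: "measure_integral p \<mu> (\<lambda>x. inverse x * ?i x + - inverse (of_nat a) * ?i x) =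
      inverse_twist \<mu> m a - inverse (of_nat a) * \<mu> m a" by simp
  have "pabs (measure_integral p \<mu> (\<lambda>x. inverse x * ?i x + - inverse (of_nat a) * ?i x)) \<le> 1 / real p ^ m"
  proof (rule pabs_measure_integral_le[OF \<mu>])
    show "continuous_on Zp_units (\<lambda>x. inverse x * ?i x + - inverse (of_nat a) * ?i x)"
      unfolding continuous_on_def
      by (intro ballI padic_tendsto_add)
         (use continuous_on_inverse_coset[of m a] c in \<open>auto simp: continuous_on_def\<close>)
    fix x :: 'c assume x: "x \<in> Zp_units"
    show "pabs (inverse x * ?i x + - inverse (of_nat a) * ?i x) \<le> 1 / real p ^ m"
    proof (cases "pabs (x - of_nat a) \<le> 1 / real p ^ m")
      case True
      have "inverse x * ?i x + - inverse (of_nat a) * ?i x = - ((x - of_nat a) * (inverse x * inverse (of_nat a)))"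
        using True Zp_units_inverse(3)[OF x] Zp_units_inverse(3)[OF u]
        by (simp add: coset_indicator_def field_simps)
      then have "pabs (inverse x * ?i x + - inverse (of_nat a) * ?i x) = pabs (x - of_nat a)"
        using Zp_units_inverse(2)[OF x] Zp_units_inverse(2)[OF u]
        by (simp add: pabs_minus pabs_mult)
      with True show ?thesis by simp
    qed (simp add: coset_indicator_def pabs_0)
  qed
  then show ?thesis by (simp only: eq)
qed

end


section \<open>Moments of the measure\<close>

lemma coprime_p_iff: "coprime c p \<longleftrightarrow> \<not> p dvd c"
  using prime_p by (metis coprime_absorb_left coprime_commute not_prime_unit prime_imp_coprime)

text \<open>The sum over multiples of p is the source of the Euler factor.\<close>

lemma sum_split_multiples:
  "(\<Sum>c=1..p * n. f c :: 'c) = (\<Sum>c | c \<in> {1..p * n} \<and> coprime c p. f c) + (\<Sum>c=1..n. f (p * c))"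
proof -
  have img: "{c \<in> {1..p * n}. \<not> coprime c p} = (\<lambda>c. p * c) ` {1..n}"
  proof (intro equalityI subsetI)
    fix c assume c: "c \<in> {c \<in> {1..p * n}. \<not> coprime c p}"
    then have "p dvd c" by (simp add: coprime_p_iff)
    then obtain b where b: "c = p * b" ..
    with c p_gt_1 have "b \<in> {1..n}" by (auto intro: gr0I)
    with b show "c \<in> (\<lambda>c. p * c) ` {1..n}" by blast
  qed (use p_gt_1 in \<open>auto simp: coprime_p_iff\<close>)
  have "(\<Sum>c=1..p * n. f c) = sum f ({c \<in> {1..p * n}. coprime c p} \<union> {c \<in> {1..p * n}. \<not> coprime c p})"
    by (intro sum.cong) auto
  also have "\<dots> = (\<Sum>c | c \<in> {1..p * n} \<and> coprime c p. f c) + sum f {c \<in> {1..p * n}. \<not> coprime c p}"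
    by (rule sum.union_disjoint) auto
  also have "sum f {c \<in> {1..p * n}. \<not> coprime c p} = (\<Sum>c=1..n. f (p * c))"
    unfolding img using p_gt_1 by (subst sum.reindex) (auto intro!: inj_onI)
  finally show ?thesis .
qed

lemma sum_coprime_regroup:
  assumes "M > 0"
  shows "(\<Sum>c | c \<in> {1..p ^ M * D} \<and> coprime c p. f c) =
    (\<Sum>a\<in>totatives (p ^ M). \<Sum>j<D. f (a + p ^ M * j) :: 'c)"
proof -
  have p_dvd: "p dvd p ^ M * j" for j using assms by (simp add: dvd_power)
  have cop: "coprime (a + p ^ M * j) p \<longleftrightarrow> coprime a p" for a j
    using p_dvd[of j] by (simp add: coprime_p_iff dvd_add_left_iff)
  \<comment> \<open>Since M > 0, both 0 and p^M D are divisible by p, so the range may start at 0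
    and stop before p^M D.\<close>
  have eq: "{c. c \<in> {1..p ^ M * D} \<and> coprime c p} = {c \<in> {..<p ^ M * D}. coprime c p}"
  proof (intro equalityI subsetI)
    fix c assume c: "c \<in> {c. c \<in> {1..p ^ M * D} \<and> coprime c p}"
    then have "c \<noteq> p ^ M * D" using p_dvd[of D] by (auto simp: coprime_p_iff)
    with c show "c \<in> {c \<in> {..<p ^ M * D}. coprime c p}" by auto
  next
    fix c assume c: "c \<in> {c \<in> {..<p ^ M * D}. coprime c p}"
    then have "c \<noteq> 0" using p_gt_1 by (auto intro: ccontr)
    with c show "c \<in> {c. c \<in> {1..p ^ M * D} \<and> coprime c p}" by auto
  qed
  have "(\<Sum>c | c \<in> {1..p ^ M * D} \<and> coprime c p. f c) =
      (\<Sum>c<p ^ M * D. if coprime c p then f c else 0)"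
    unfolding eq by (rule sum.inter_filter) simp
  also have "\<dots> = (\<Sum>a<p ^ M. if coprime a p then \<Sum>j<D. f (a + p ^ M * j) else 0)"
    unfolding sum_lessThan_mult cop by (intro sum.cong) auto
  also have "\<dots> = (\<Sum>a\<in>totatives (p ^ M). \<Sum>j<D. f (a + p ^ M * j))"
    unfolding totatives_p_power[OF assms] by (subst sum.inter_filter[symmetric]) auto
  finally show ?thesis .
qed

text \<open>The sum \<open>W M\<close> of g c * c^k over c up to p^M D prime to p is computed twice:
  by \<open>periodic_power_sum\<close>, as p^M D times the Euler-corrected combination
  \<open>Y M\<close> of values of Q, and by first-order expansion, as -k p^M D \<open>R M\<close> up
  to an error p^(-2M). Dividing by p^M D leaves an error p^-M, and Y tends to a multiple of
  Q(0).\<close>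

lemma class_value_moments:
  assumes h: "zero_sum_periodic D h" and D: "coprime D p" and h_le: "\<And>n. pabs (h n) \<le> 1"
    and \<theta>: "\<And>c. \<theta> (c mod p ^ n) = \<theta> c" and \<theta>_le: "\<And>n. pabs (\<theta> n) \<le> 1"
    and g: "zero_sum_periodic (D * p ^ n) (\<lambda>c. \<theta> c * h c)"
    and mult: "\<And>c. \<theta> (p * c) * h (p * c) = \<theta> p * h p * (\<theta> c * h c)"
    and "k > 0"
  shows "(\<lambda>M. \<Sum>a\<in>totatives (p ^ M). \<theta> a * of_nat a ^ (k - 1) * class_value D h M a) \<longlonglongrightarrow>
    (1 - \<theta> p * h p * of_nat p ^ (k - 1)) * regularized_value (D * p ^ n) (\<lambda>c. \<theta> c * h c) k"
proof -
  define g where "g = (\<lambda>c. \<theta> c * h c)"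
  define R where "R = (\<lambda>M. \<Sum>a\<in>totatives (p ^ M). \<theta> a * of_nat a ^ (k - 1) * class_value D h M a)"
  have g_le: "pabs (g c) \<le> 1" for c
    using h_le \<theta>_le by (simp add: g_def pabs_mult mult_le_one pabs_nonneg)
  have D0: "(of_nat D :: 'c) \<noteq> 0"
    using h by (simp add: zero_sum_periodic_def)
  obtain Q where Q: "\<And>t. (\<Sum>m=1..t * (D * p ^ n). g m * of_nat m ^ k) =
        of_nat (t * (D * p ^ n)) * poly Q (of_nat (t * (D * p ^ n)))"
      "poly Q 0 = - of_nat k * regularized_value (D * p ^ n) g k"
    by (rule periodic_power_sum[OF g[folded g_def] \<open>k > 0\<close>]) (rule that)
  \<comment> \<open>For M at least n, p^M D is the p^(M-n)-fold of the period D p^n.\<close>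
  have S: "(\<Sum>m=1..p ^ M * D. g m * of_nat m ^ k) = of_nat (p ^ M * D) * poly Q (of_nat (p ^ M * D))"
    if "M \<ge> n" for M
  proof -
    have "p ^ (M - n) * (D * p ^ n) = p ^ M * D"
      using that by (simp add: power_diff_power_eq power_add[symmetric] mult_ac)
    with Q(1)[of "p ^ (M - n)"] show ?thesis by simp
  qed
  define W where "W = (\<lambda>M. \<Sum>a\<in>totatives (p ^ M). \<Sum>j<D. g (a + p ^ M * j) * of_nat (a + p ^ M * j) ^ k)"
  \<comment> \<open>Multiples of p contribute g p * p^k times the power sum at level M - 1; one
    factor of p^k restores the common factor p^M D, and p^(k-1) is left. Level M - 1 must also be at
    least n, hence the condition \<open>Suc n\<close> on M below.\<close>
  define Y where "Y = (\<lambda>M. poly Q (of_nat (p ^ M * D)) -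
      g p * of_nat p ^ (k - 1) * poly Q (of_nat (p ^ (M - 1) * D)))"
  have W: "W M = of_nat (p ^ M * D) * Y M" if M: "M \<ge> Suc n" for M
  proof -
    obtain M' where M': "M = Suc M'" "M' \<ge> n" using M by (cases M) auto
    have k: "of_nat p ^ k = of_nat p * (of_nat p ^ (k - 1) :: 'c)"
      using \<open>k > 0\<close> by (cases k) auto
    have "(\<Sum>c=1..p ^ M * D. g c * of_nat c ^ k) =
        (\<Sum>c | c \<in> {1..p ^ M * D} \<and> coprime c p. g c * of_nat c ^ k) +
        (\<Sum>c=1..p ^ M' * D. g (p * c) * of_nat (p * c) ^ k)"
      using sum_split_multiples[of "\<lambda>c. g c * of_nat c ^ k" "p ^ M' * D"] by (simp add: M'(1) mult.assoc)
    also have "(\<Sum>c | c \<in> {1..p ^ M * D} \<and> coprime c p. g c * of_nat c ^ k) = W M"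
      unfolding W_def using M by (intro sum_coprime_regroup) simp
    also have "(\<Sum>c=1..p ^ M' * D. g (p * c) * of_nat (p * c) ^ k) =
        g p * of_nat p ^ k * (\<Sum>c=1..p ^ M' * D. g c * of_nat c ^ k)"
      unfolding sum_distrib_left
    proof (intro sum.cong refl)
      fix c
      have "g (p * c) = g p * g c" using mult[of c] by (simp add: g_def)
      then show "g (p * c) * of_nat (p * c) ^ k = g p * of_nat p ^ k * (g c * of_nat c ^ k)"
        by (simp add: power_mult_distrib mult_ac)
    qed
    finally have "W M = (\<Sum>c=1..p ^ M * D. g c * of_nat c ^ k) -
        g p * of_nat p ^ k * (\<Sum>c=1..p ^ M' * D. g c * of_nat c ^ k)" by simp
    also have "\<dots> = of_nat (p ^ M * D) * poly Q (of_nat (p ^ M * D)) -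
        g p * of_nat p ^ k * (of_nat (p ^ M' * D) * poly Q (of_nat (p ^ M' * D)))"
      using M M' by (subst (1 2) S) auto
    also have "\<dots> = of_nat (p ^ M * D) * Y M"
      unfolding Y_def k by (simp add: M'(1) algebra_simps)
    finally show ?thesis .
  qed
  have WR: "pabs (W M + of_nat (p ^ M * D) * (of_nat k * R M)) \<le> (1 / real p ^ M) * (1 / real p ^ M)"
    if M: "M \<ge> Suc n" for M
  proof -
    \<comment> \<open>The second-order remainder of (a + p^M j)^k, divisible by p^(2M).\<close>
    define E where "E = (\<lambda>a j. of_nat (a + p ^ M * j) ^ k - of_nat a ^ k
        - of_nat k * of_nat a ^ (k - 1) * of_nat (p ^ M * j) :: 'c)"
    have E_le: "pabs (E a j) \<le> (1 / real p ^ M) * (1 / real p ^ M)" for a j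
    proof -
      obtain w where "(a + p ^ M * j) ^ k = a ^ k + k * a ^ (k - 1) * (p ^ M * j) + (p ^ M * j) ^ 2 * w"
        using power_add_expansion by blast
      then have "(of_nat ((a + p ^ M * j) ^ k) :: 'c) =
          of_nat (a ^ k + k * a ^ (k - 1) * (p ^ M * j) + (p ^ M * j) ^ 2 * w)" by (rule arg_cong)
      then have "E a j = of_nat (p ^ M) * (of_nat (p ^ M) * of_nat (j ^ 2 * w))"
        by (simp add: E_def power2_eq_square algebra_simps)
      then have "pabs (E a j) = (1 / real p ^ M) * (1 / real p ^ M) * pabs (of_nat (j ^ 2 * w) :: 'c)"
        by (simp only: pabs_mult pabs_p_power mult.assoc)
      also have "\<dots> \<le> (1 / real p ^ M) * (1 / real p ^ M) * 1"
        by (intro mult_left_mono pabs_of_nat) auto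
      finally show ?thesis by simp
    qed
    have per: "\<theta> (a + p ^ M * j) = \<theta> a" for a j
    proof -
      have "p ^ M * j = p ^ n * (p ^ (M - n) * j)"
        using M by (simp add: power_add[symmetric] mult.assoc[symmetric])
      then have "(a + p ^ M * j) mod p ^ n = a mod p ^ n" by (simp only: mod_mult_self2)
      then show ?thesis using \<theta>[of "a + p ^ M * j"] \<theta>[of a] by simp
    qed
    \<comment> \<open>In the sum over j, the zeroth-order term vanishes by the zero sum of h along
      the progression, and the first-order term cancels the class value; only the remainder
      survives.\<close>
    have inner: "(\<Sum>j<D. g (a + p ^ M * j) * of_nat (a + p ^ M * j) ^ k) +
        of_nat (p ^ M * D) * (of_nat k * (\<theta> a * of_nat a ^ (k - 1) * class_value D h M a)) =
        (\<Sum>j<D. g (a + p ^ M * j) * E a j)" for a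
    proof -
      have "zero_sum_periodic D (\<lambda>j. h (a + p ^ M * j))"
        by (intro zero_sum_periodic_progression h coprime_p_power D)
      then have zero: "(\<Sum>j<D. h (a + p ^ M * j)) = 0" by (simp add: zero_sum_periodic_def)
      have cv: "of_nat D * class_value D h M a = - (\<Sum>j<D. h (a + p ^ M * j) * of_nat j)"
        using D0 by (simp add: class_value_def)
      have "of_nat (p ^ M * D) * (of_nat k * (\<theta> a * of_nat a ^ (k - 1) * class_value D h M a)) =
          of_nat (p ^ M) * of_nat k * \<theta> a * of_nat a ^ (k - 1) * (of_nat D * class_value D h M a)"
        by (simp add: mult_ac)
      also have "\<dots> = - (\<Sum>j<D. \<theta> a * h (a + p ^ M * j) * (of_nat k * of_nat a ^ (k - 1) * of_nat (p ^ M * j)))"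
        unfolding cv by (simp add: sum_distrib_left sum_negf mult_ac)
      finally have 1: "of_nat (p ^ M * D) * (of_nat k * (\<theta> a * of_nat a ^ (k - 1) * class_value D h M a)) =
          - (\<Sum>j<D. \<theta> a * h (a + p ^ M * j) * (of_nat k * of_nat a ^ (k - 1) * of_nat (p ^ M * j)))" .
      have "(\<Sum>j<D. \<theta> a * h (a + p ^ M * j) * of_nat a ^ k) = \<theta> a * of_nat a ^ k * (\<Sum>j<D. h (a + p ^ M * j))"
        by (simp add: sum_distrib_left mult_ac)
      then have 2: "(\<Sum>j<D. \<theta> a * h (a + p ^ M * j) * of_nat a ^ k) = 0" by (simp add: zero)
      show ?thesis
        unfolding 1 using 2
        by (simp only: g_def per E_def right_diff_distrib sum_subtractf) simp
    qed
    have "W M + of_nat (p ^ M * D) * (of_nat k * R M) =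
        (\<Sum>a\<in>totatives (p ^ M). \<Sum>j<D. g (a + p ^ M * j) * E a j)"
      unfolding W_def R_def sum_distrib_left sum.distrib[symmetric] 
      by (intro sum.cong refl inner[unfolded sum_distrib_left])
    also have "pabs \<dots> \<le> (1 / real p ^ M) * (1 / real p ^ M)"
    proof (intro pabs_sum_le)
      fix a j
      have "pabs (g (a + p ^ M * j)) * pabs (E a j) \<le> 1 * ((1 / real p ^ M) * (1 / real p ^ M))"
        by (intro mult_mono g_le E_le pabs_nonneg) auto
      then show "pabs (g (a + p ^ M * j) * E a j) \<le> (1 / real p ^ M) * (1 / real p ^ M)"
        by (simp add: pabs_mult)
    qed auto
    finally show ?thesis .
  qed
  have "pabs (Y M + of_nat k * R M) \<le> 1 / real p ^ M" if M: "M \<ge> Suc n" for M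
  proof -
    have "pabs (of_nat (p ^ M * D) * (Y M + of_nat k * R M)) \<le> (1 / real p ^ M) * (1 / real p ^ M)"
      using WR[OF M] unfolding W[OF M] by (simp only: distrib_left)
    moreover have "pabs (of_nat (p ^ M * D) * (Y M + of_nat k * R M)) =
        (1 / real p ^ M) * pabs (Y M + of_nat k * R M)"
      unfolding of_nat_mult pabs_mult pabs_p_power pabs_of_nat_coprime[OF D] by simp
    ultimately have "(1 / real p ^ M) * pabs (Y M + of_nat k * R M) \<le> (1 / real p ^ M) * (1 / real p ^ M)"
      by simp
    then show ?thesis
      using p_gt_1 by (subst (asm) mult_le_cancel_left_pos) auto
  qed
  then have lim0: "(\<lambda>M. Y M + of_nat k * R M) \<longlonglongrightarrow> 0"
    by (rule padic_tendsto_0)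
  have pD: "(\<lambda>M. of_nat (p ^ M * D) :: 'c) \<longlonglongrightarrow> 0"
    using padic_tendsto_mult[OF p_power_tendsto_0 tendsto_const[of "of_nat D"]] by simp
  have pD': "(\<lambda>M. of_nat (p ^ (M - 1) * D) :: 'c) \<longlonglongrightarrow> 0"
    by (rule LIMSEQ_imp_Suc) (use pD in simp)
  have "Y \<longlonglongrightarrow> poly Q 0 - g p * of_nat p ^ (k - 1) * poly Q 0"
    unfolding Y_def
    by (intro padic_tendsto_diff padic_tendsto_mult tendsto_const padic_tendsto_poly pD pD')
  \<comment> \<open>k may be divisible by p, but it is fixed while M grows, so dividing by it does
    not disturb the limit.\<close>
  with lim0 have "(\<lambda>M. inverse (of_nat k) * ((Y M + of_nat k * R M) - Y M)) \<longlonglongrightarrow>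
      inverse (of_nat k) * (0 - (poly Q 0 - g p * of_nat p ^ (k - 1) * poly Q 0))"
    by (intro padic_tendsto_mult padic_tendsto_diff tendsto_const)
  moreover have "inverse (of_nat k) * ((Y M + of_nat k * R M) - Y M) = R M" for M
    using \<open>k > 0\<close> by simp
  moreover have "inverse (of_nat k) * (0 - (poly Q 0 - g p * of_nat p ^ (k - 1) * poly Q 0)) =
      (1 - g p * of_nat p ^ (k - 1)) * regularized_value (D * p ^ n) g k"
    using \<open>k > 0\<close> by (simp add: Q(2) field_simps)
  ultimately have "(\<lambda>M. R M) \<longlonglongrightarrow>
      (1 - g p * of_nat p ^ (k - 1)) * regularized_value (D * p ^ n) g k"
    by (simp only:)
  then show ?thesis by (simp only: R_def g_def)
qed


section \<open>Coefficients in a finite extension\<close>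

lemma Zp_subset_finite_extension:
  assumes "finite_extension_Qp (L :: 'c set)"
  shows "Zp \<subseteq> L"
proof -
  have "(\<int> :: 'c set) \<subseteq> \<rat>" by (auto elim!: Ints_cases)
  then have "(Zp :: 'c set) \<subseteq> Qp" unfolding Zp_def Qp_def by (rule closure_mono)
  then show ?thesis using assms by (auto simp: finite_extension_Qp_def)
qed

lemma finite_extension_sum:
  assumes "finite_extension_Qp (L :: 'c set)" "\<And>i. i \<in> I \<Longrightarrow> f i \<in> L"
  shows "sum f I \<in> L"
proof -
  have diff: "x - y \<in> L" if "x \<in> L" "y \<in> L" for x y
    using assms(1) that by (auto simp: finite_extension_Qp_def)
  have 0: "0 \<in> L"
    using Zp_subset_finite_extension[OF assms(1)] Ints_in_Zp[of 0] by auto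
  have add: "x + y \<in> L" if "x \<in> L" "y \<in> L" for x y
    using diff[OF that(1) diff[OF 0 that(2)]] by simp
  show ?thesis
    using assms(2) by (induction I rule: infinite_finite_induct) (auto simp: 0 add)
qed

text \<open>For integer values all Riemann sums of positive level lie in \<open>Zp\<close>, which is
  closed.\<close>

lemma inverse_twist_in_Zp:
  assumes e: "zero_sum_periodic D e" and D: "coprime D p" and Ints: "\<And>n. e n \<in> \<int>"
    and a: "a \<in> totatives (p ^ m)"
  shows "inverse_twist (value_measure D e) m a \<in> Zp"
proof -
  have le: "pabs (e n) \<le> 1" for n
    using Ints[of n] by (auto elim!: Ints_cases simp: pabs_of_int)
  have "value_measure D e \<in> iwasawa_algebra p UNIV"
    by (rule value_measure_in_iwasawa[OF e D le])
  then have lim: "riemann_sum p (value_measure D e) (\<lambda>x. inverse x * coset_indicator m a x) \<longlonglongrightarrow>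
      inverse_twist (value_measure D e) m a"
    using riemann_sum_tendsto[OF _ continuous_on_inverse_coset] a by (simp add: inverse_twist_def)
  have nat: "(of_nat n :: 'c) \<in> Zp" for n by (rule Ints_in_Zp) simp
  have D_inv: "inverse (of_nat D :: 'c) \<in> Zp"
    by (intro Zp_inverse nat pabs_of_nat_coprime D)
  have "(\<Sum>j<D. e (c + p ^ M * j) * of_nat j) \<in> \<int>" for c M
    using Ints by (intro Ints_sum Ints_mult) auto
  then have cv: "class_value D e M c \<in> Zp" for M c
    unfolding class_value_def divide_inverse
    by (intro Zp_mult D_inv Ints_in_Zp) simp
  have "riemann_sum p (value_measure D e) (\<lambda>x. inverse x * coset_indicator m a x) M \<in> Zp" if "M > 0" for M
    unfolding riemann_sum_def
  proof (intro Zp_sum Zp_mult)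
    fix c assume c: "c \<in> totatives (p ^ M)"
    show "inverse (of_nat c :: 'c) \<in> Zp"
      by (rule Zp_units_inverse(1)[OF of_nat_in_Zp_units[OF c \<open>M > 0\<close>]])
    show "coset_indicator m a (of_nat c) \<in> Zp"
      by (rule Ints_in_Zp) (simp add: coset_indicator_def)
    show "value_measure D e M c \<in> Zp"
      using cv c \<open>M > 0\<close> by (simp add: value_measure_def)
  qed
  then have "\<forall>\<^sub>F M in sequentially.
      riemann_sum p (value_measure D e) (\<lambda>x. inverse x * coset_indicator m a x) M \<in> Zp"
    using eventually_gt_at_top[of 0] by (rule eventually_mono[rotated])
  then show ?thesis
    by (rule Lim_in_closed_set[OF Zp_closed _ _ lim]) simp
qed

text \<open>
  Expanding \<open>h\<close> in integer-valued zero-sum sequences writes the twist as a combination of elements of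
  \<open>Zp\<close> with coefficients \<open>h d\<close>; it therefore lies in \<open>L\<close>, and one does not need that \<open>L\<close> is closed.
\<close>

lemma inverse_twist_in_finite_extension:
  assumes L: "finite_extension_Qp (L :: 'c set)" and h: "zero_sum_periodic D h" and D: "coprime D p"
    and h_le: "\<And>n. pabs (h n) \<le> 1" and h_L: "\<And>n. h n \<in> L" and a: "a \<in> totatives (p ^ m)"
  shows "inverse_twist (value_measure D h) m a \<in> L"
proof -
  \<comment> \<open>The indicator of the class d, corrected at the class 0 so as to have zero sum.
    The corrections add up to the sum of all h d, which is 0, so h d remains the
    coefficient.\<close>
  define e :: "nat \<Rightarrow> nat \<Rightarrow> 'c" where
    "e = (\<lambda>d n. (if n mod D = d then 1 else 0) - (if n mod D = 0 then 1 else 0))"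
  let ?r = "\<lambda>h. riemann_sum p (value_measure D h) (\<lambda>x. inverse x * coset_indicator m a x)"
  have D0: "D > 0" using h by (simp add: zero_sum_periodic_def)
  have e: "zero_sum_periodic D (e d)" if "d < D" for d
    unfolding zero_sum_periodic_def
  proof (intro conjI allI)
    have "(\<Sum>n<D. e d n) = (\<Sum>n<D. (if n = d then 1 else 0) - (if n = 0 then 1 else 0))"
      by (intro sum.cong) (auto simp: e_def)
    then show "(\<Sum>n<D. e d n) = 0"
      using that D0 by (simp add: sum_subtractf)
  qed (simp_all add: D0 e_def)
  have e_Ints: "e d n \<in> \<int>" for d n by (simp add: e_def)
  have e_le: "pabs (e d n) \<le> 1" for d n
    using e_Ints[of d n] by (auto elim!: Ints_cases simp: pabs_of_int)
  have expand: "h n = (\<Sum>d<D. h d * e d n)" for n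
  proof -
    have "(\<Sum>d<D. h d * e d n) = (\<Sum>d<D. (if n mod D = d then h d else 0)) - 
        (if n mod D = 0 then 1 else 0) * (\<Sum>d<D. h d)"
      unfolding sum_distrib_left sum_subtractf[symmetric] by (intro sum.cong) (auto simp: e_def algebra_simps)
    also have "\<dots> = h (n mod D)"
      using h D0 by (simp add: zero_sum_periodic_def)
    finally show ?thesis using zero_sum_periodic_mod[OF h, of n] by simp
  qed
  have "class_value D h M c = - (\<Sum>j<D. (\<Sum>d<D. h d * e d (c + p ^ M * j)) * of_nat j) / of_nat D" for M c
    unfolding class_value_def expand[symmetric] ..
  also have "- (\<Sum>j<D. (\<Sum>d<D. h d * e d (c + p ^ M * j)) * of_nat j) / of_nat D =
      (\<Sum>d<D. h d * class_value D (e d) M c)" for M c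
    unfolding class_value_def sum_distrib_right
    by (subst sum.swap) (simp add: sum_distrib_left sum_negf sum_divide_distrib mult_ac)
  finally have cv: "class_value D h M c = (\<Sum>d<D. h d * class_value D (e d) M c)" for M c .
  have vm: "value_measure D h M c = (\<Sum>d<D. h d * value_measure D (e d) M c)" for M c
    unfolding value_measure_def cv by (auto simp: sum_distrib_left intro: sum.swap)
  have r: "?r h M = (\<Sum>d<D. h d * ?r (e d) M)" for M
    unfolding riemann_sum_def vm sum_distrib_left
    by (subst sum.swap) (intro sum.cong refl, simp add: mult_ac)
  have lim: "?r g \<longlonglongrightarrow> inverse_twist (value_measure D g) m a"
    if "zero_sum_periodic D g" "\<And>n. pabs (g n) \<le> 1" for g
    using riemann_sum_tendsto[OF value_measure_in_iwasawa[OF that(1) D that(2)]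
        continuous_on_inverse_coset] a by (simp add: inverse_twist_def)
  have "?r h \<longlonglongrightarrow> (\<Sum>d<D. h d * inverse_twist (value_measure D (e d)) m a)"
    unfolding r by (intro padic_tendsto_sum padic_tendsto_mult tendsto_const lim e e_le) auto
  then have "inverse_twist (value_measure D h) m a = (\<Sum>d<D. h d * inverse_twist (value_measure D (e d)) m a)"
    by (rule LIMSEQ_unique[OF lim[OF h h_le]])
  also have "\<dots> \<in> L"
  proof (rule finite_extension_sum[OF L])
    fix d assume "d \<in> {..<D}"
    then have "inverse_twist (value_measure D (e d)) m a \<in> L"
      using inverse_twist_in_Zp[OF e D e_Ints a] Zp_subset_finite_extension[OF L] by auto
    then show "h d * inverse_twist (value_measure D (e d)) m a \<in> L"
      using L h_L[of d] by (auto simp: finite_extension_Qp_def)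
  qed
  finally show ?thesis .
qed


section \<open>A measure is determined by its moments\<close>

text \<open>From k * (q choose k) = q * ((q - 1) choose (k - 1)) with q = p^n: a binomial
  coefficient prime to p would force p^n to divide k.\<close>

lemma prime_dvd_choose_power:
  assumes "0 < k" "k < p ^ n"
  shows "p dvd (p ^ n choose k)"
proof (rule ccontr)
  assume "\<not> p dvd (p ^ n choose k)"
  then have "coprime (p ^ n) (p ^ n choose k)"
    by (simp add: coprime_p_iff[symmetric] coprime_commute)
  moreover obtain k' q' where "k = Suc k'" "p ^ n = Suc q'"
    using assms by (metis gr0_conv_Suc less_trans)
  then have "k * (p ^ n choose k) = p ^ n * (q' choose k')"
    using Suc_times_binomial_eq[of q' k'] by (simp add: mult.commute)
  then have "p ^ n dvd k * (p ^ n choose k)" by simp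
  ultimately have "p ^ n dvd k" by (simp add: coprime_dvd_mult_left_iff)
  with assms show False by (auto dest: dvd_imp_le)
qed

text \<open>By Vandermonde, all terms but the one with k = 0 contain a binomial coefficient
  divisible by p.\<close>

lemma choose_periodic:
  assumes "j < p ^ n"
  shows "[(m + p ^ n) choose j = m choose j] (mod p)"
proof -
  have "(p ^ n + m) choose j = (\<Sum>k\<le>j. (p ^ n choose k) * (m choose (j - k)))"
    by (rule vandermonde[symmetric])
  also have "\<dots> = (m choose j) + (\<Sum>k\<in>{..j} - {0}. (p ^ n choose k) * (m choose (j - k)))"
    by (subst sum.remove[of _ 0]) auto
  finally have "(m + p ^ n) choose j = (m choose j) + (\<Sum>k\<in>{..j} - {0}. (p ^ n choose k) * (m choose (j - k)))"
    by (simp add: add.commute)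
  moreover have "p dvd (\<Sum>k\<in>{..j} - {0}. (p ^ n choose k) * (m choose (j - k)))"
    using assms by (intro dvd_sum dvd_mult2 prime_dvd_choose_power) auto
  ultimately show ?thesis
    by (simp add: Cong.cong_def mod_add_eq[symmetric] dvd_eq_mod_eq_0)
qed

text \<open>By periodicity z - 1 may be replaced by its residue r below p^n, and r choose (p^n - 1)
  is 1 for r = p^n - 1 and 0 otherwise.\<close>

lemma choose_coprime_iff:
  assumes "z > 0"
  shows "coprime ((z - 1) choose (p ^ n - 1)) p \<longleftrightarrow> p ^ n dvd z"
proof -
  let ?q = "p ^ n"
  have q: "?q > 0" using p_gt_1 by simp
  define r where "r = (z - 1) mod ?q"
  have "[(r + t * ?q) choose (?q - 1) = r choose (?q - 1)] (mod p)" for t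
  proof (induction t)
    case (Suc t)
    have "[(r + t * ?q + ?q) choose (?q - 1) = (r + t * ?q) choose (?q - 1)] (mod p)"
      using q by (intro choose_periodic) auto
    with Suc show ?case by (simp add: add_ac cong_trans)
  qed simp
  from this[of "(z - 1) div ?q"] have "[(z - 1) choose (?q - 1) = r choose (?q - 1)] (mod p)"
    unfolding r_def by (simp only: mod_div_mult_eq)
  then have "coprime ((z - 1) choose (?q - 1)) p \<longleftrightarrow> coprime (r choose (?q - 1)) p"
    using cong_imp_coprime cong_sym by blast
  also have "\<dots> \<longleftrightarrow> r = ?q - 1"
  proof (cases "r = ?q - 1")
    case False
    have "r < ?q" unfolding r_def using q by simp
    with False have zero: "r choose (?q - 1) = 0" by (intro binomial_eq_0) auto
    have "\<not> coprime 0 p" using p_gt_1 by simp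
    with False show ?thesis unfolding zero by blast
  qed simp
  also have "\<dots> \<longleftrightarrow> ?q dvd z"
  proof -
    have "Suc r mod ?q = z mod ?q"
      using assms by (simp add: r_def mod_Suc_eq)
    moreover have "r < ?q" unfolding r_def using q by simp
    ultimately show ?thesis
      using q by (auto simp: dvd_eq_mod_eq_0 mod_Suc split: if_splits)
  qed
  finally show ?thesis .
qed

text \<open>
  Modulo \<open>p\<close>, the binomial coefficient is nonzero exactly on the coset; raising to a multiple of
  \<open>totient (p ^ N)\<close> turns its nonzero values into 1 modulo \<open>p ^ N\<close>. The factor \<open>b\<close> is harmless on units
  and removes the constant term.
\<close>

lemma ex_poly_approx_coset_indicator:
  assumes a: "a \<in> totatives (p ^ n)"
  obtains q :: "'c poly" where "poly q 0 = 0"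
    "\<And>b. b > 0 \<Longrightarrow> coprime b p \<Longrightarrow> pabs (poly q (of_nat b) - coset_indicator n a (of_nat b)) \<le> 1 / real p ^ N"
proof -
  define K where "K = p ^ n - 1"
  \<comment> \<open>Adding d turns the congruence of b and a modulo p^n into divisibility of b + d
    by p^n, which \<open>choose_coprime_iff\<close> detects; \<open>r\<close> interpolates (b + d -
    1) choose K.\<close>
  define d where "d = p ^ n - a"
  have a_le: "a \<le> p ^ n" using a totatives_le by blast
  define r :: "'c poly" where
    "r = smult (inverse (fact K)) (\<Prod>i = 0..<K. [:of_nat d - 1 - of_nat i, 1:])"
  \<comment> \<open>The totient serves Euler's theorem on the coset; the factor \<open>Suc N\<close>
    gives t at least N, so that off the coset divisibility by p becomes divisibility by p^N.\<close>
  define t where "t = totient (p ^ N) * Suc N"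
  have tot: "totient (p ^ N) > 0" using p_gt_1 by simp
  have t_ge: "t \<ge> N"
    using tot by (cases "totient (p ^ N)") (auto simp: t_def)
  define q where "q = ([:0, 1:] * r) ^ t"
  have r: "poly r (of_nat b) = of_nat ((b + d - 1) choose K)" if "b > 0" for b
  proof -
    have "(of_nat (b + d - 1) :: 'c) = of_nat b + (of_nat d - 1)"
      using that by (simp add: of_nat_diff)
    then have "(of_nat ((b + d - 1) choose K) :: 'c) = (of_nat b + (of_nat d - 1)) gchoose K"
      by (simp add: binomial_gbinomial)
    also have "\<dots> = poly r (of_nat b)"
      by (simp add: r_def gbinomial_prod_rev poly_prod divide_inverse algebra_simps)
    finally show ?thesis ..
  qed
  show ?thesis
  proof
    have "t > 0" using tot by (simp add: t_def)
    then show "poly q 0 = 0" by (simp add: q_def poly_power)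
    fix b assume b: "b > 0" "coprime b p"
    let ?x = "b * ((b + d - 1) choose K)"
    have q: "poly q (of_nat b) = of_nat (?x ^ t)"
      using r[OF b(1)] by (simp add: q_def poly_power)
    have x: "coprime ?x p \<longleftrightarrow> [b = a] (mod p ^ n)"
    proof -
      have "coprime ?x p \<longleftrightarrow> p ^ n dvd b + d"
        using b choose_coprime_iff[of "b + d" n] by (simp add: K_def)
      also have "\<dots> \<longleftrightarrow> [b + d = a + d] (mod p ^ n)"
        using a_le by (simp add: d_def Cong.cong_def dvd_eq_mod_eq_0)
      also have "\<dots> \<longleftrightarrow> [b = a] (mod p ^ n)" by (rule cong_add_rcancel_nat)
      finally show ?thesis .
    qed
    have "[?x ^ t = (if [b = a] (mod p ^ n) then 1 else 0)] (mod p ^ N)"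
    proof (cases "[b = a] (mod p ^ n)")
      case True
      then have "coprime ?x (p ^ N)" using x by simp
      then have "[(?x ^ totient (p ^ N)) ^ Suc N = 1 ^ Suc N] (mod p ^ N)"
        by (intro cong_pow euler_theorem)
      then show ?thesis using True by (simp add: t_def power_mult[symmetric] del: power_Suc)
    next
      case False
      then have "p dvd ?x" using x coprime_p_iff by blast
      then have "p ^ N dvd ?x ^ t"
        using t_ge by (rule dvd_power_le)
      then show ?thesis using False by (simp add: cong_0_iff)
    qed
    then have "pabs (of_nat (?x ^ t) - of_nat (if [b = a] (mod p ^ n) then 1 else 0) :: 'c) \<le> 1 / real p ^ N"
      by (simp only: pabs_diff_le_iff_cong)
    then show "pabs (poly q (of_nat b) - coset_indicator n a (of_nat b)) \<le> 1 / real p ^ N"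
      by (simp add: q coset_indicator_of_nat del: of_nat_power of_nat_mult split: if_splits)
  qed
qed

text \<open>Nothing is known about the total mass, so only polynomials without constant term are
  known to integrate to 0. They approximate a coset indicator within p^-N on units, so a coset has
  mass at most p^-N for every N.\<close>

lemma iwasawa_eq_0_if_moments_0:
  assumes \<nu>: "\<nu> \<in> iwasawa_algebra p (L :: 'c set)"
    and mom: "\<And>k. k > 0 \<Longrightarrow> riemann_sum p \<nu> (\<lambda>x. x ^ k) \<longlonglongrightarrow> 0"
  shows "\<nu> n a = 0"
proof (cases "a \<in> totatives (p ^ n)")
  case True
  have poly0: "riemann_sum p \<nu> (poly q) \<longlonglongrightarrow> 0" if "poly q 0 = 0" for q
  proof -
    have "riemann_sum p \<nu> (poly q) M = (\<Sum>i\<le>degree q. coeff q i * riemann_sum p \<nu> (\<lambda>x. x ^ i) M)" for M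
      unfolding riemann_sum_def poly_altdef sum_distrib_left sum_distrib_right
      by (subst sum.swap) (simp add: mult_ac)
    then have "riemann_sum p \<nu> (poly q) =
        (\<lambda>M. \<Sum>i\<le>degree q. coeff q i * riemann_sum p \<nu> (\<lambda>x. x ^ i) M)" by (rule ext)
    moreover have "(\<lambda>M. \<Sum>i\<le>degree q. coeff q i * riemann_sum p \<nu> (\<lambda>x. x ^ i) M) \<longlonglongrightarrow> (\<Sum>i\<le>degree q. 0)"
    proof (rule padic_tendsto_sum)
      fix i
      show "(\<lambda>M. coeff q i * riemann_sum p \<nu> (\<lambda>x. x ^ i) M) \<longlonglongrightarrow> 0"
      proof (cases "i = 0")
        case True
        then show ?thesis using that by (simp add: poly_0_coeff_0)
      next
        case False
        then show ?thesis
          using padic_tendsto_mult[OF tendsto_const mom[of i], of "coeff q i"] by simp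
      qed
    qed
    ultimately show ?thesis by simp
  qed
  have ind: "riemann_sum p \<nu> (coset_indicator n a) \<longlonglongrightarrow> \<nu> n a"
    using riemann_sum_tendsto[OF \<nu> continuous_on_coset_indicator, of n a]
      measure_integral_coset[OF \<nu> True] by (simp add: coset_indicator_def[abs_def])
  have "pabs (\<nu> n a) \<le> 1 / real p ^ N" for N
  proof -
    obtain q :: "'c poly" where q: "poly q 0 = 0" "\<And>b. b > 0 \<Longrightarrow> coprime b p \<Longrightarrow>
        pabs (poly q (of_nat b) - coset_indicator n a (of_nat b)) \<le> 1 / real p ^ N"
      using ex_poly_approx_coset_indicator[OF True] by metis
    have "(\<lambda>M. riemann_sum p \<nu> (coset_indicator n a) M - riemann_sum p \<nu> (poly q) M) \<longlonglongrightarrow> \<nu> n a - 0"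
      by (intro padic_tendsto_diff ind poly0 q)
    then have "(\<lambda>M. pabs (riemann_sum p \<nu> (coset_indicator n a) M - riemann_sum p \<nu> (poly q) M)) \<longlonglongrightarrow> pabs (\<nu> n a)"
      unfolding pabs_def by (intro tendsto_dist tendsto_const) simp
    then show ?thesis
    proof (rule tendsto_upperbound)
      have "pabs (riemann_sum p \<nu> (coset_indicator n a) M - riemann_sum p \<nu> (poly q) M) \<le> 1 / real p ^ N"
        if "M > 0" for M
      proof -
        have "riemann_sum p \<nu> (coset_indicator n a) M - riemann_sum p \<nu> (poly q) M =
            (\<Sum>b\<in>totatives (p ^ M). (coset_indicator n a (of_nat b) - poly q (of_nat b)) * \<nu> M b)"
          by (simp add: riemann_sum_def sum_subtractf left_diff_distrib)
        also have "pabs \<dots> \<le> 1 / real p ^ N"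
        proof (rule pabs_sum_le)
          fix b assume b: "b \<in> totatives (p ^ M)"
          then have "b > 0" "coprime b p"
            using that totatives_coprime by (auto simp: in_totatives_iff)
          then have "pabs (coset_indicator n a (of_nat b) - poly q (of_nat b)) \<le> 1 / real p ^ N"
            using q(2) pabs_minus by (metis minus_diff_eq)
          moreover have "pabs (\<nu> M b) \<le> 1"
            using \<nu> b unfolding iwasawa_algebra_def ring_of_integers_def by blast
          ultimately have "pabs (coset_indicator n a (of_nat b) - poly q (of_nat b)) * pabs (\<nu> M b) \<le>
              1 / real p ^ N * 1" by (intro mult_mono pabs_nonneg) auto
          then show "pabs ((coset_indicator n a (of_nat b) - poly q (of_nat b)) * \<nu> M b) \<le> 1 / real p ^ N"
            by (simp add: pabs_mult)
        qed simp
        finally show ?thesis .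
      qed
      then show "\<forall>\<^sub>F M in sequentially. pabs (riemann_sum p \<nu> (coset_indicator n a) M -
          riemann_sum p \<nu> (poly q) M) \<le> 1 / real p ^ N"
        using eventually_gt_at_top[of 0] by (rule eventually_mono[rotated])
    qed simp
  qed
  then have "\<not> pabs (\<nu> n a) > 0"
    using ex_inv_p_power_less[of "pabs (\<nu> n a)"] by (meson not_le)
  then show ?thesis using pabs_nonneg[of "\<nu> n a"] pabs_eq_0_iff[of "\<nu> n a"] by simp
qed (use \<nu> in \<open>auto simp: iwasawa_algebra_def\<close>)

lemma iwasawa_eqI:
  assumes \<mu>: "\<mu> \<in> iwasawa_algebra p (L :: 'c set)" and \<nu>: "\<nu> \<in> iwasawa_algebra p L"
    and mom: "\<And>k. k > 0 \<Longrightarrow> measure_integral p \<mu> (\<lambda>x. x ^ k) = measure_integral p \<nu> (\<lambda>x. x ^ k)"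
  shows "\<mu> = \<nu>"
proof (intro ext)
  fix n a
  let ?d = "\<lambda>n a. \<mu> n a - \<nu> n a"
  have "?d \<in> iwasawa_algebra p (UNIV :: 'c set)"
    unfolding iwasawa_algebra_def mem_Collect_eq
  proof (intro conjI allI impI ballI)
    fix n a assume "a \<in> totatives (p ^ n)"
    then have "pabs (\<mu> n a) \<le> 1" "pabs (\<nu> n a) \<le> 1"
      using \<mu> \<nu> unfolding iwasawa_algebra_def ring_of_integers_def by blast+
    then show "?d n a \<in> ring_of_integers UNIV"
      using pabs_diff[of "\<mu> n a" "\<nu> n a"] by (simp add: ring_of_integers_def)
  next
    fix n a assume "a \<notin> totatives (p ^ n)"
    then show "?d n a = 0" using \<mu> \<nu> by (simp add: iwasawa_algebra_def)
  next
    fix n b assume "b \<in> totatives (p ^ n)"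
    then show "(\<Sum>a | a \<in> totatives (p ^ Suc n) \<and> [a = b] (mod p ^ n). ?d (Suc n) a) = ?d n b"
      using \<mu> \<nu> by (simp add: iwasawa_algebra_def sum_subtractf del: power_Suc)
  qed
  moreover have "riemann_sum p ?d (\<lambda>x. x ^ k) \<longlonglongrightarrow> 0" if "k > 0" for k
  proof -
    have cont: "continuous_on Zp_units (\<lambda>x :: 'c. x ^ k)"
      using continuous_on_poly_padic[of Zp_units "monom 1 k"] by (simp add: poly_monom)
    have "riemann_sum p ?d (\<lambda>x. x ^ k) = (\<lambda>M. riemann_sum p \<mu> (\<lambda>x. x ^ k) M - riemann_sum p \<nu> (\<lambda>x. x ^ k) M)"
      by (rule ext) (simp add: riemann_sum_def sum_subtractf right_diff_distrib)
    then show ?thesis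
      using padic_tendsto_diff[OF riemann_sum_tendsto[OF \<mu> cont] riemann_sum_tendsto[OF \<nu> cont]]
        mom[OF that] by simp
  qed
  ultimately have "?d n a = 0" by (rule iwasawa_eq_0_if_moments_0)
  then show "\<mu> n a = \<nu> n a" by simp
qed

end


section \<open>Dirichlet characters\<close>

lemma dirichlet_character_cong:
  assumes "dirichlet_character N \<psi>" "[a = b] (mod int N)"
  shows "\<psi> a = \<psi> b"
proof -
  have per: "\<psi> (a + int N) = \<psi> a" for a
    using assms(1) by (simp add: dirichlet_character_def)
  have nat: "\<psi> (a + int N * int t) = \<psi> a" for a t
  proof (induction t)
    case (Suc t)
    then show ?case using per[of "a + int N * int t"] by (simp add: algebra_simps)
  qed simp
  obtain t where t: "b = a + int N * t"
    using assms(2) by (metis cong_iff_lin)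
  show ?thesis
  proof (cases "t \<ge> 0")
    case True
    then show ?thesis using nat[of a "nat t"] t by simp
  next
    case False
    then show ?thesis using nat[of b "nat (- t)"] t by simp
  qed
qed

lemma dirichlet_character_power:
  assumes "dirichlet_character N \<psi>"
  shows "\<psi> (a ^ m) = \<psi> a ^ m"
  using assms by (induction m) (auto simp: dirichlet_character_def)

lemma dirichlet_character_root_of_unity:
  assumes "dirichlet_character N \<psi>"
  shows "\<psi> (int c) = 0 \<or> \<psi> (int c) ^ totient N = 1"
proof (cases "coprime c N")
  case True
  then have "[c ^ totient N = 1] (mod N)" by (rule euler_theorem)
  then have "[int c ^ totient N = 1] (mod int N)"
    by (metis cong_int_iff of_nat_1 of_nat_power)
  then have "\<psi> (int c ^ totient N) = \<psi> 1"
    by (rule dirichlet_character_cong[OF assms])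
  then show ?thesis
    using assms unfolding dirichlet_character_power[OF assms] by (simp add: dirichlet_character_def)
qed (use assms in \<open>simp add: dirichlet_character_def\<close>)

text \<open>Primitivity for the divisor 1 gives a unit with character value other than 1;
  multiplying by it permutes the residues and rescales the sum.\<close>

lemma zero_sum_periodic_primitive_character:
  fixes \<psi> :: "int \<Rightarrow> 'a::field_char_0"
  assumes "primitive_dirichlet_character N \<psi>" "N > 1"
  shows "zero_sum_periodic N (\<lambda>n. \<psi> (int n))"
  unfolding zero_sum_periodic_def
proof (intro conjI allI)
  have \<psi>: "dirichlet_character N \<psi>"
    using assms(1) by (simp add: primitive_dirichlet_character_def)
  show "N > 0" using assms(2) by simp
  show "\<psi> (int (n + N)) = \<psi> (int n)" for n
    using \<psi> by (simp add: dirichlet_character_def)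
  obtain a where a: "coprime a (int N)" "\<psi> a \<noteq> 1"
    using assms unfolding primitive_dirichlet_character_def by (metis One_nat_def one_dvd)
  define b where "b = nat (a mod int N)"
  have b: "int b = a mod int N" using assms(2) by (simp add: b_def)
  have "coprime (int b) (int N)" using a(1) assms(2) by (simp add: b)
  then have cop: "coprime b N" by simp
  have "\<psi> (int b) = \<psi> a"
    by (rule dirichlet_character_cong[OF \<psi>]) (simp add: b Cong.cong_def)
  with a(2) have b1: "\<psi> (int b) \<noteq> 1" by simp
  have mod: "\<psi> (int n) = \<psi> (int (n mod N))" for n
    by (rule dirichlet_character_cong[OF \<psi>]) (simp add: Cong.cong_def zmod_int)
  have "(\<Sum>n<N. \<psi> (int (0 + b * n))) = (\<Sum>n<N. \<psi> (int n))"
    by (rule sum_progression[of "\<lambda>n. \<psi> (int n)", OF mod]) (use assms(2) cop in auto)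
  then have "\<psi> (int b) * (\<Sum>n<N. \<psi> (int n)) = (\<Sum>n<N. \<psi> (int n))"
    using \<psi> by (simp add: dirichlet_character_def sum_distrib_left)
  with b1 show "(\<Sum>n<N. \<psi> (int n)) = 0" by simp
qed

text \<open>Within a class modulo q, \<theta> is constant and h sums to zero along the progression.
  Thus the product has zero sum even when \<theta> is the trivial character.\<close>

lemma zero_sum_periodic_product:
  fixes h :: "nat \<Rightarrow> 'a::field_char_0"
  assumes h: "zero_sum_periodic D h" and \<theta>: "\<And>n. \<theta> (n + q) = \<theta> n" and "q > 0" "coprime q D"
  shows "zero_sum_periodic (D * q) (\<lambda>n. \<theta> n * h n)"
  unfolding zero_sum_periodic_def
proof (intro conjI allI)
  show "D * q > 0" using h \<open>q > 0\<close> by (simp add: zero_sum_periodic_def)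
  have \<theta>_mult: "\<theta> (n + q * t) = \<theta> n" for n t
  proof (induction t)
    case (Suc t)
    then show ?case using \<theta>[of "n + q * t"] by (simp add: algebra_simps)
  qed simp
  show "\<theta> (n + D * q) * h (n + D * q) = \<theta> n * h n" for n
    using \<theta>_mult[of n D] zero_sum_periodic_mod[OF h, of "n + D * q"] zero_sum_periodic_mod[OF h, of n]
    by (simp add: mult.commute)
  have "(\<Sum>n<D * q. \<theta> n * h n) = (\<Sum>n<q * D. \<theta> n * h n)" by (simp only: mult.commute)
  also have "\<dots> = (\<Sum>i<q. \<theta> i * (\<Sum>j<D. h (i + q * j)))"
    unfolding sum_lessThan_mult by (simp add: \<theta>_mult sum_distrib_left)
  also have "\<dots> = 0"
    using zero_sum_periodic_progression[OF h \<open>coprime q D\<close>] by (simp add: zero_sum_periodic_def)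
  finally show "(\<Sum>n<D * q. \<theta> n * h n) = 0" .
qed

context padic_complex_field
begin

section \<open>Characters on the units and twisted integrals\<close>

lemma pabs_root_of_unity:
  assumes "x = 0 \<or> x ^ m = (1 :: 'c)" "m > 0"
  shows "pabs x \<le> 1"
  using assms(1)
proof
  assume "x ^ m = 1"
  then have "pabs x ^ m = 1" by (metis pabs_power pabs_1)
  then show ?thesis using one_less_power[OF _ \<open>m > 0\<close>, of "pabs x"] by force
qed (simp add: pabs_0)

lemma unit_residue_of_nat:
  assumes "a \<in> totatives (p ^ M)" "n \<le> M"
  shows "unit_residue p n (of_nat a :: 'c) = totative_mod n a"
  unfolding unit_residue_def
proof (rule the_equality)
  let ?t = "totative_mod n a"
  have t: "?t \<in> totatives (p ^ n)" by (rule totative_mod_in[OF assms])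
  then have "[a = ?t] (mod p ^ n)" using totative_mod_eq_iff[of ?t n a] by simp
  then have "[int a = int ?t] (mod int p ^ n)" by (metis cong_int_iff of_nat_power)
  then obtain y where "int a - int ?t = int p ^ n * y"
    by (metis cong_iff_dvd_diff dvdE)
  then have "(of_int (int a - int ?t) :: 'c) = of_int (int p ^ n * y)" by (rule arg_cong)
  then have "of_nat a - of_nat ?t = (of_nat p ^ n * of_int y :: 'c)" by simp
  moreover have "(of_int y :: 'c) \<in> Zp" by (rule Ints_in_Zp) simp
  ultimately show "?t \<in> totatives (p ^ n) \<and> (\<exists>y\<in>Zp. of_nat a - of_nat ?t = (of_nat p ^ n * y :: 'c))"
    using t by blast
  fix b assume b: "b \<in> totatives (p ^ n) \<and> (\<exists>y\<in>Zp. of_nat a - of_nat b = (of_nat p ^ n * y :: 'c))"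
  then obtain y :: 'c where y: "y \<in> Zp" "of_nat a - of_nat b = of_nat p ^ n * y" by blast
  have "pabs (of_nat a - of_nat b :: 'c) = (1 / real p ^ n) * pabs y"
    unfolding y(2) using pabs_p_power[of n] by (simp add: pabs_mult)
  also have "\<dots> \<le> (1 / real p ^ n) * 1"
    by (intro mult_left_mono pabs_Zp_le_1 y(1)) simp
  finally have "[a = b] (mod p ^ n)" by (simp add: pabs_diff_le_iff_cong)
  then show "b = ?t" using totative_mod_eq_iff[of b n a] b by simp
qed

text \<open>At level M the twisted mass is a^-1 times the original one up to p^-M, so the Riemann
  sums of \<phi> x^k for the twist and of \<phi> x^(k-1) for the original measure have the same
  limit.\<close>

lemma inverse_twist_integral:
  assumes h: "zero_sum_periodic D h" and D: "coprime D p" and h_le: "\<And>n. pabs (h n) \<le> 1"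
    and \<theta>_le: "\<And>n. pabs (\<theta> n) \<le> 1" and "k > 0"
    and \<phi>: "\<And>M a. M \<ge> n \<Longrightarrow> a \<in> totatives (p ^ M) \<Longrightarrow> \<phi> (of_nat a) = \<theta> a"
    and lim: "(\<lambda>M. \<Sum>a\<in>totatives (p ^ M). \<theta> a * of_nat a ^ (k - 1) * class_value D h M a) \<longlonglongrightarrow> l"
  shows "measure_integral p (inverse_twist (value_measure D h)) (\<lambda>x. \<phi> x * x ^ k) = l"
proof -
  let ?\<mu> = "value_measure D h"
  let ?\<zeta> = "inverse_twist ?\<mu>"
  have \<mu>: "?\<mu> \<in> iwasawa_algebra p UNIV"
    by (rule value_measure_in_iwasawa[OF h D h_le])
  define R where "R = (\<lambda>M. \<Sum>a\<in>totatives (p ^ M). \<theta> a * of_nat a ^ (k - 1) * class_value D h M a)"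
  define S where "S = riemann_sum p ?\<zeta> (\<lambda>x. \<phi> x * x ^ k)"
  have "pabs (S M - R M) \<le> 1 / real p ^ M" if M: "M \<ge> Suc n" for M
  proof -
    have "S M - R M = (\<Sum>a\<in>totatives (p ^ M). \<theta> a * of_nat a ^ k * (?\<zeta> M a - inverse (of_nat a) * ?\<mu> M a))"
      unfolding S_def R_def riemann_sum_def sum_subtractf[symmetric]
    proof (intro sum.cong refl)
      fix a assume a: "a \<in> totatives (p ^ M)"
      have a0: "(of_nat a :: 'c) \<noteq> 0"
        using a by (auto simp: in_totatives_iff)
      have k: "of_nat a ^ k = of_nat a * (of_nat a ^ (k - 1) :: 'c)"
        using \<open>k > 0\<close> by (cases k) auto
      have "\<phi> (of_nat a) = \<theta> a" using M by (intro \<phi>[OF _ a]) simp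
      moreover have "?\<mu> M a = class_value D h M a" using a M by (simp add: value_measure_def)
      ultimately show "\<phi> (of_nat a) * of_nat a ^ k * ?\<zeta> M a - \<theta> a * of_nat a ^ (k - 1) * class_value D h M a =
          \<theta> a * of_nat a ^ k * (?\<zeta> M a - inverse (of_nat a) * ?\<mu> M a)"
        using a0 unfolding k by (simp add: field_simps)
    qed
    also have "pabs \<dots> \<le> 1 / real p ^ M"
    proof (rule pabs_sum_le)
      fix a assume a: "a \<in> totatives (p ^ M)"
      have "pabs (\<theta> a * of_nat a ^ k) \<le> 1"
        using \<theta>_le[of a] pabs_of_nat[of a]
        by (simp add: pabs_mult pabs_power mult_le_one power_le_one pabs_nonneg)
      then have "pabs (\<theta> a * of_nat a ^ k) * pabs (?\<zeta> M a - inverse (of_nat a) * ?\<mu> M a) \<le> 1 * (1 / real p ^ M)"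
        using inverse_twist_approx[OF \<mu> a] M by (intro mult_mono pabs_nonneg) auto
      then show "pabs (\<theta> a * of_nat a ^ k * (?\<zeta> M a - inverse (of_nat a) * ?\<mu> M a)) \<le> 1 / real p ^ M"
        by (simp add: pabs_mult)
    qed simp
    finally show ?thesis .
  qed
  then have "(\<lambda>M. S M - R M) \<longlonglongrightarrow> 0" by (rule padic_tendsto_0)
  from padic_tendsto_add[OF this lim[folded R_def]] have "S \<longlonglongrightarrow> l" by simp
  then show ?thesis by (simp add: measure_integral_def S_def limI)
qed

end

text \<open>The interpolation formula equates elements of two different fields; it is expressed by
  an algebraic number z with prescribed images under both embeddings.\<close>

theorem theorem5p7:
  fixes p D :: nat
    and \<iota>C :: "rat alg_closure \<Rightarrow> complex"
    and \<iota>p :: "rat alg_closure \<Rightarrow> 'c::{field_char_0, complete_space}"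
    and L :: "'c set"
    and \<eta> :: "int \<Rightarrow> rat alg_closure"
  assumes "padic_complex_field TYPE('c) p" and "odd p"
    and "D > 1" and "coprime D p"
    and "field_embedding \<iota>C" and "field_embedding \<iota>p"
    and "primitive_dirichlet_character D \<eta>"
    and "finite_extension_Qp L" and "\<forall>a. \<iota>p (\<eta> a) \<in> L"
  shows "\<exists>!\<zeta>. \<zeta> \<in> iwasawa_algebra p L \<and>
    (\<forall>n \<psi> k. primitive_dirichlet_character (p ^ n) \<psi> \<and> k > 0 \<longrightarrow>
      (\<exists>z. \<iota>C z = (1 - \<iota>C (\<psi> (int p) * \<eta> (int p)) * of_nat p ^ (k - 1)) *
                  dirichlet_L (\<lambda>a. \<iota>C (\<psi> a * \<eta> a)) (1 - of_nat k) \<and>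
           measure_integral p \<zeta> (\<lambda>x. \<iota>p (char_on_units p n \<psi> x) * x ^ k) = \<iota>p z))"
    (is "\<exists>!\<zeta>. \<zeta> \<in> _ \<and> ?P \<zeta>")
proof -
  interpret padic_complex_field "TYPE('c)" p by (rule assms(1))
  define h where "h = (\<lambda>n. \<iota>p (\<eta> (int n)))"
  have \<eta>: "dirichlet_character D \<eta>"
    using assms(7) by (simp add: primitive_dirichlet_character_def)
  have \<eta>_zero: "zero_sum_periodic D (\<lambda>n. \<eta> (int n))"
    by (rule zero_sum_periodic_primitive_character[OF assms(7,3)])
  have h: "zero_sum_periodic D h"
    unfolding h_def by (rule field_embedding_zero_sum_periodic[OF assms(6) \<eta>_zero])
  have char_le: "pabs (\<iota>p (\<psi> (int c))) \<le> 1" if "dirichlet_character N \<psi>" for \<psi> N c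
  proof (rule pabs_root_of_unity)
    show "\<iota>p (\<psi> (int c)) = 0 \<or> \<iota>p (\<psi> (int c)) ^ totient N = 1"
      using dirichlet_character_root_of_unity[OF that, of c]
      by (auto simp flip: field_embedding_simps(8)[OF assms(6)] simp: field_embedding_simps(1,2)[OF assms(6)])
    show "totient N > 0" using that by (simp add: dirichlet_character_def)
  qed
  have h_le: "pabs (h n) \<le> 1" for n
    unfolding h_def by (rule char_le[OF \<eta>])
  define \<zeta> where "\<zeta> = inverse_twist (value_measure D h)"
  have \<zeta>: "\<zeta> \<in> iwasawa_algebra p L"
    unfolding \<zeta>_def
    by (intro inverse_twist_in_iwasawa[OF value_measure_in_iwasawa]
        inverse_twist_in_finite_extension assms h h_le) (use assms(9) in \<open>simp add: h_def\<close>)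
  have "?P \<zeta>"
  proof (intro allI impI, elim conjE)
    fix n k :: nat and \<psi> :: "int \<Rightarrow> rat alg_closure"
    assume prim: "primitive_dirichlet_character (p ^ n) \<psi>" and k: "k > 0"
    have \<psi>: "dirichlet_character (p ^ n) \<psi>"
      using prim by (simp add: primitive_dirichlet_character_def)
    define \<theta> where "\<theta> = (\<lambda>c. \<iota>p (\<psi> (int c)))"
    have mod: "\<psi> (int (c mod p ^ n)) = \<psi> (int c)" for c
      by (rule dirichlet_character_cong[OF \<psi>]) (simp add: Cong.cong_def zmod_int)
    have prod: "zero_sum_periodic (D * p ^ n) (\<lambda>c. \<psi> (int c) * \<eta> (int c))"
      by (rule zero_sum_periodic_product[OF \<eta>_zero])
         (use \<psi> assms(4) coprime_p_power in \<open>auto simp: dirichlet_character_def\<close>)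
    \<comment> \<open>The right-hand side computed inside \<open>rat alg_closure\<close>, before any
      embedding.\<close>
    define z where "z = (1 - \<psi> (int p) * \<eta> (int p) * of_nat p ^ (k - 1)) *
      regularized_value (D * p ^ n) (\<lambda>c. \<psi> (int c) * \<eta> (int c)) k"
    have "\<iota>C z = (1 - \<iota>C (\<psi> (int p) * \<eta> (int p)) * of_nat p ^ (k - 1)) *
        dirichlet_L (\<lambda>a. \<iota>C (\<psi> a * \<eta> a)) (1 - of_nat k)"
      unfolding dirichlet_L_neg_int[of "D * p ^ n" "\<lambda>a. \<iota>C (\<psi> a * \<eta> a)",
          OF field_embedding_zero_sum_periodic[OF assms(5) prod] k]
      by (simp add: z_def field_embedding_simps[OF assms(5)] field_embedding_regularized_value[OF assms(5)])
    moreover have "measure_integral p \<zeta> (\<lambda>x. \<iota>p (char_on_units p n \<psi> x) * x ^ k) = \<iota>p z"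
      unfolding \<zeta>_def
    proof (rule inverse_twist_integral[OF h assms(4) h_le])
      show "pabs (\<theta> c) \<le> 1" for c
        unfolding \<theta>_def by (rule char_le[OF \<psi>])
      show "\<iota>p (char_on_units p n \<psi> (of_nat a :: 'c)) = \<theta> a" if a: "M \<ge> n" "a \<in> totatives (p ^ M)" for M a
      proof -
        \<comment> \<open>For n = 0 \<open>totative_mod\<close> returns the representative 1 instead
          of the remainder 0; modulo 1 both have the same character value.\<close>
        have "\<psi> (int (totative_mod n a)) = \<psi> (int a)"
          using mod[of a] mod[of 1] by (cases "n = 0") (simp_all add: totative_mod_def)
        then show ?thesis
          using unit_residue_of_nat[OF a(2,1)] by (simp add: char_on_units_def \<theta>_def)
      qed
      have eq: "\<theta> c * h c = \<iota>p (\<psi> (int c) * \<eta> (int c))" for c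
        by (simp add: \<theta>_def h_def field_embedding_simps(6)[OF assms(6)])
      have "\<iota>p z = (1 - \<theta> p * h p * of_nat p ^ (k - 1)) * regularized_value (D * p ^ n) (\<lambda>c. \<theta> c * h c) k"
        unfolding eq z_def
        by (simp add: field_embedding_simps[OF assms(6)] field_embedding_regularized_value[OF assms(6)])
      moreover have "(\<lambda>M. \<Sum>a\<in>totatives (p ^ M). \<theta> a * of_nat a ^ (k - 1) * class_value D h M a) \<longlonglongrightarrow>
          (1 - \<theta> p * h p * of_nat p ^ (k - 1)) * regularized_value (D * p ^ n) (\<lambda>c. \<theta> c * h c) k"
      proof (rule class_value_moments[OF h assms(4) h_le _ _ _ _ k])
        show "\<theta> (c mod p ^ n) = \<theta> c" for c by (simp add: \<theta>_def mod)
        show "pabs (\<theta> c) \<le> 1" for c unfolding \<theta>_def by (rule char_le[OF \<psi>])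
        show "zero_sum_periodic (D * p ^ n) (\<lambda>c. \<theta> c * h c)"
          unfolding eq by (rule field_embedding_zero_sum_periodic[OF assms(6) prod])
        show "\<theta> (p * c) * h (p * c) = \<theta> p * h p * (\<theta> c * h c)" for c
          using \<psi> \<eta> by (simp add: \<theta>_def h_def dirichlet_character_def field_embedding_simps(6)[OF assms(6)])
      qed
      ultimately show "(\<lambda>M. \<Sum>a\<in>totatives (p ^ M). \<theta> a * of_nat a ^ (k - 1) * class_value D h M a) \<longlonglongrightarrow> \<iota>p z"
        by simp
    qed (rule k)
    ultimately show "\<exists>z. \<iota>C z = (1 - \<iota>C (\<psi> (int p) * \<eta> (int p)) * of_nat p ^ (k - 1)) *
                  dirichlet_L (\<lambda>a. \<iota>C (\<psi> a * \<eta> a)) (1 - of_nat k) \<and>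
           measure_integral p \<zeta> (\<lambda>x. \<iota>p (char_on_units p n \<psi> x) * x ^ k) = \<iota>p z" by blast
  qed
  moreover have "\<zeta>' = \<zeta>" if \<zeta>': "\<zeta>' \<in> iwasawa_algebra p L" "?P \<zeta>'" for \<zeta>'
  proof (rule iwasawa_eqI[OF \<zeta>'(1) \<zeta>])
    fix k :: nat assume k: "k > 0"
    \<comment> \<open>The character of conductor p^0 = 1, whose twisted moments are the plain
      moments of x^k.\<close>
    let ?\<psi> = "\<lambda>a :: int. 1 :: rat alg_closure"
    have prim: "primitive_dirichlet_character (p ^ 0) ?\<psi>"
      by (simp add: primitive_dirichlet_character_def dirichlet_character_def)
    have fn: "(\<lambda>x. \<iota>p (char_on_units p 0 ?\<psi> x) * x ^ k) = (\<lambda>x. x ^ k)"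
      by (simp add: char_on_units_def field_embedding_simps(2)[OF assms(6)])
    obtain z where z: "\<iota>C z = (1 - \<iota>C (1 * \<eta> (int p)) * of_nat p ^ (k - 1)) *
        dirichlet_L (\<lambda>a. \<iota>C (1 * \<eta> a)) (1 - of_nat k)" "measure_integral p \<zeta> (\<lambda>x. x ^ k) = \<iota>p z"
      using \<open>?P \<zeta>\<close>[rule_format, of 0 ?\<psi> k] prim k unfolding fn by blast
    obtain z' where z': "\<iota>C z' = (1 - \<iota>C (1 * \<eta> (int p)) * of_nat p ^ (k - 1)) *
        dirichlet_L (\<lambda>a. \<iota>C (1 * \<eta> a)) (1 - of_nat k)" "measure_integral p \<zeta>' (\<lambda>x. x ^ k) = \<iota>p z'"
      using \<zeta>'(2)[rule_format, of 0 ?\<psi> k] prim k unfolding fn by blast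
    \<comment> \<open>The complex L-value determines the algebraic number because \<iota>C is
      injective, and thereby the p-adic moment.\<close>
    have "z' = z" using z(1) z'(1) by (intro field_embedding_inj[OF assms(5)]) simp
    then show "measure_integral p \<zeta>' (\<lambda>x. x ^ k) = measure_integral p \<zeta> (\<lambda>x. x ^ k)"
      using z(2) z'(2) by simp
  qed
  ultimately show ?thesis using \<zeta> by (intro ex1I[of _ \<zeta>]) blast+
qed

end
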